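(* Let $n\ge1$ and let $m$ be a positive integer. Let $\eta=(\eta_1,\dots,\eta_n)$ be a vector of integers or of half-integers with $m>\eta_1>\dots>\eta_n\ge0$, and let $\lambda=(\lambda_1,\dots,\lambda_n)$ be a vector of integers or of half-integers with $m>\lambda_{s+1}>\dots>\lambda_n>\lambda_1>\dots>\lambda_s\ge0$ for some $s$. Then, as $k\to\infty$ with $k\equiv2\eta_j+2\lambda_j\pmod2$, the number of walks on the $m$-circle from $\eta$ to $\lambda$ with exactly $k$ diagonal steps, such that at no time two coordinates of a point of the walk are equal, is asymptotically $$\frac{2^{n^2-n}}{nm^n}\left(2^n\prod_{j=1}^n\cos\frac{\pi(j-\frac{n+1}2)}{m}\right)^k\prod_{1\le h<t\le n}\left(\sin\frac{\pi(\eta_h-\eta_t)}{m}\cdot\left|\sin\frac{\pi(\lambda_h-\lambda_t)}{m}\right|\right).$$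
   Context: A half-integer is an odd integer divided by $2$. Walks on the $m$-circle are walks in $n$-space where each coordinate is taken modulo $m$. A walk with $k$ diagonal steps from $\eta$ to $\lambda$ is a sequence $p_0=\eta,\dots,p_k=\lambda$ of such points with $p_i-p_{i-1}\in\{(\pm\frac12,\dots,\pm\frac12)\}$ (all sign patterns); the condition is that for every $i$ and $h\ne t$ the $h$-th and $t$-th coordinates of $p_i$ are distinct modulo $m$. "Asymptotically $E$" means the ratio of the count to $E$ tends to $1$. *)

theory Defs
  imports Complex_Main "HOL-Library.FuncSet" "HOL-Library.Real_Mod"
begin

definition half_integer :: "real \<Rightarrow> bool" where
  "half_integer x \<longleftrightarrow> (\<exists>z::int. odd z \<and> x = of_int z / 2)"

text \<open>A vector of dimension \<open>n\<close> is a function on indices, of which only \<open>1, \<dots>, n\<close> are relevant.\<close>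

definition int_or_half_int_vector :: "nat \<Rightarrow> (nat \<Rightarrow> real) \<Rightarrow> bool" where
  "int_or_half_int_vector n v \<longleftrightarrow>
     (\<forall>j\<in>{1..n}. v j \<in> \<int>) \<or> (\<forall>j\<in>{1..n}. half_integer (v j))"

text \<open>For a list with entries \<open>x\<^sub>1, \<dots>, x\<^sub>r\<close>: the chain \<open>m > x\<^sub>1 > \<dots> > x\<^sub>r \<ge> 0\<close>.\<close>

definition decreasing_chain :: "nat \<Rightarrow> real list \<Rightarrow> bool" where
  "decreasing_chain m xs \<longleftrightarrow> sorted_wrt (>) xs \<and> (\<forall>x\<in>set xs. 0 \<le> x \<and> x < real m)"

text \<open>
  A walk on the \<open>m\<close>-circle is a walk in \<open>n\<close>-space whose coordinates are read modulo \<open>m\<close>.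
  It is represented by its lift to \<open>n\<close>-space that starts at \<open>\<eta>\<close> itself and hence
  ends at a point congruent to \<open>\<lambda>\<close> modulo \<open>m\<close>. For \<open>m \<ge> 2\<close> these lifts correspond one-to-one to
  sequences of residue vectors; for \<open>m = 1\<close>, where \<open>1/2\<close> and \<open>-1/2\<close> are congruent,
  the lifts still distinguish the two steps. Extensional functions are used so that
  distinct elements of the set are distinct walks.
\<close>

definition diagonal_walks ::
    "nat \<Rightarrow> nat \<Rightarrow> (nat \<Rightarrow> real) \<Rightarrow> (nat \<Rightarrow> real) \<Rightarrow> nat \<Rightarrow> (nat \<Rightarrow> nat \<Rightarrow> real) set" where
  "diagonal_walks n m \<eta> lam k =
     {p \<in> {0..k} \<rightarrow>\<^sub>E ({1..n} \<rightarrow>\<^sub>E UNIV).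
        (\<forall>j\<in>{1..n}. p 0 j = \<eta> j) \<and>
        (\<forall>j\<in>{1..n}. [p k j = lam j] (rmod (real m))) \<and>
        (\<forall>i<k. \<forall>j\<in>{1..n}. p (Suc i) j - p i j \<in> {1/2, -1/2})}"

definition nonintersecting :: "nat \<Rightarrow> nat \<Rightarrow> nat \<Rightarrow> (nat \<Rightarrow> nat \<Rightarrow> real) \<Rightarrow> bool" where
  "nonintersecting n m k p \<longleftrightarrow>
     (\<forall>i\<le>k. \<forall>h\<in>{1..n}. \<forall>t\<in>{1..n}. h \<noteq> t \<longrightarrow> \<not> [p i h = p i t] (rmod (real m)))"

definition num_nonintersecting_walks ::
    "nat \<Rightarrow> nat \<Rightarrow> (nat \<Rightarrow> real) \<Rightarrow> (nat \<Rightarrow> real) \<Rightarrow> nat \<Rightarrow> nat" where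
  "num_nonintersecting_walks n m \<eta> lam k =
     card {p \<in> diagonal_walks n m \<eta> lam k. nonintersecting n m k p}"

end

theory Submission
  imports Defs "HOL-Combinatorics.Permutations" "HOL-Computational_Algebra.Polynomial"
    "HOL-Library.Infinite_Set"
begin

text \<open>
  Adding \<open>i/2\<close> to the \<open>i\<close>-th point turns the steps into vectors of \<open>{0, 1}\<^sup>n\<close>, so that one has
  to count walks of a fixed length on the finite set of residue vectors modulo \<open>m\<close> that come from
  the alcove \<open>x\<^sub>1 > \<dots> > x\<^sub>n > x\<^sub>1 - m\<close>. By Vandermonde's formula,
  \<open>\<Prod>\<^bsub>h<t\<^esub> sin (\<pi> (x\<^sub>h - x\<^sub>t) / m)\<close> is an antisymmetrised sum of plane waves, all with the same
  eigenvalue \<open>\<rho> = 2\<^sup>n \<Prod>\<^sub>j cos (\<pi> (j - (n + 1) / 2) / m)\<close> under summation over the steps. It vanishes on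
  the walls and is positive inside the alcove, so it is a left and right Perron eigenvector \<open>h\<close> of
  the transfer matrix. Every configuration \<open>y\<close> can be reached from every \<open>x\<close> along
  \<open>min (x + i, y)\<close>, and a Perron-Frobenius argument gives
  \<open>\<rho>\<^sup>k h(x) h(y) / \<Sum>\<^sub>z h(z)\<^sup>2\<close> as the asymptotic number of walks. The sum of squares follows from
  the orthogonality of characters modulo \<open>m\<close>.
\<close>

subsection \<open>Vandermonde's formula\<close>

text \<open>The shift by i/2 is what makes Perron-Frobenius applicable. With steps of plus or minus
  1/2 a walk alternates between integer and half-integer points, and its matrix would be periodic;
  with steps in {0, 1} a coordinate may rest, and the matrix becomes primitive. The price is a
  target that drifts: the shifted endpoint depends on the length k, so the limit is needed for all
  of the finitely many endpoints at once.

  The chain for \<open>\<eta>\<close> forces \<open>n \<le> m\<close>. This keeps the angles of the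
  cosines inside (-pi/2, pi/2), so that the eigenvalue is positive, and makes the frequencies 1,
  ..., n distinct modulo m, so that their characters are orthogonal.

  In the constant, 2^(n^2 - n) is the squared modulus of the product of the factors -2i that turn
  sines into differences of exponentials, m^n is the number of residue vectors, and n is the number
  of orders, out of n!, in which n distinct residues lie in the alcove modulo m: the cyclic
  rotations of the decreasing order.\<close>

definition vandermonde_sum :: "nat \<Rightarrow> (nat \<Rightarrow> 'a :: field_char_0) \<Rightarrow> 'a" where
  "vandermonde_sum n z = (\<Sum>p | p permutes {1..n}. of_int (sign p) * (\<Prod>i=1..n. z i ^ (p i - 1)))"

text \<open>Composing every permutation with the transposition of \<open>a\<close> and
  \<open>b\<close> flips its sign and leaves its monomial unchanged, so the sum is its own negative;
  in characteristic 0 it vanishes.\<close>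

lemma vandermonde_sum_eq_0:
  assumes "a \<in> {1..n}" "b \<in> {1..n}" "a \<noteq> b" "z a = z b"
  shows "vandermonde_sum n z = 0"
proof -
  let ?t = "transpose a b"
  have t: "?t permutes {1..n}"
    using assms by (simp add: permutes_swap_id)
  have "vandermonde_sum n z =
      (\<Sum>p | p permutes {1..n}. of_int (sign (p \<circ> ?t)) * (\<Prod>i=1..n. z i ^ ((p \<circ> ?t) i - 1)))"
    unfolding vandermonde_sum_def by (rule sum_permutations_compose_right[OF t])
  also have "\<dots> = (\<Sum>p | p permutes {1..n}. - (of_int (sign p) * (\<Prod>i=1..n. z i ^ (p i - 1))))"
  proof (rule sum.cong[OF refl])
    fix p assume "p \<in> {p. p permutes {1..n}}"
    then have p: "p permutes {1..n}" by simp
    have "sign (p \<circ> ?t) = sign p * sign ?t"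
      using p t by (intro sign_compose) (auto intro: permutes_imp_permutation)
    also have "\<dots> = - sign p"
      using assms by (simp add: sign_swap_id)
    finally have s: "sign (p \<circ> ?t) = - sign p" .
    have "(\<Prod>i=1..n. z i ^ (p i - 1)) = (\<Prod>i=1..n. z (?t i) ^ (p (?t i) - 1))"
      using prod.permute[OF t, of "\<lambda>i. z i ^ (p i - 1)"] by (simp add: o_def)
    also have "\<dots> = (\<Prod>i=1..n. z i ^ ((p \<circ> ?t) i - 1))"
      using assms by (intro prod.cong) (auto simp: transpose_def)
    finally show "of_int (sign (p \<circ> ?t)) * (\<Prod>i=1..n. z i ^ ((p \<circ> ?t) i - 1)) =
        - (of_int (sign p) * (\<Prod>i=1..n. z i ^ (p i - 1)))"
      by (simp add: s)
  qed
  also have "\<dots> = - vandermonde_sum n z"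
    unfolding vandermonde_sum_def by (simp add: sum_negf)
  finally show ?thesis by simp
qed

lemma vandermonde_sum_Suc:
  fixes z :: "nat \<Rightarrow> 'a :: field_char_0"
  assumes inj: "inj_on z {1..n}"
  shows "vandermonde_sum (Suc n) z = vandermonde_sum n z * (\<Prod>j=1..n. z (Suc n) - z j)"
proof -
  let ?S = "{p. p permutes {1..Suc n}}"
  let ?c = "\<lambda>p. of_int (sign p) * (\<Prod>i=1..n. z i ^ (p i - 1))"
  \<comment> \<open>Both sides as polynomials in \<open>z (Suc n)\<close>: same degree, roots and leading coefficient.\<close>
  define P where "P = (\<Sum>p\<in>?S. monom (?c p) (p (Suc n) - 1))"
  define Q where "Q = Polynomial.smult (vandermonde_sum n z) (\<Prod>j=1..n. [:- z j, 1:])"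
  have fin: "finite ?S" by (simp add: finite_permutations)
  have P_eval: "poly P t = vandermonde_sum (Suc n) (z(Suc n := t))" for t
    unfolding P_def vandermonde_sum_def poly_sum
  proof (rule sum.cong[OF refl])
    fix p assume "p \<in> ?S"
    have "(\<Prod>i=1..n. (z(Suc n := t)) i ^ (p i - 1)) = (\<Prod>i=1..n. z i ^ (p i - 1))"
      by (intro prod.cong) auto
    then show "poly (monom (?c p) (p (Suc n) - 1)) t =
        of_int (sign p) * (\<Prod>i=1..Suc n. (z(Suc n := t)) i ^ (p i - 1))"
      by (simp add: poly_monom mult_ac)
  qed
  have degQ: "degree (\<Prod>j=1..n. [:- z j, 1:]) = n"
    by (subst degree_prod_eq_sum_degree) auto
  have "P = Q"
  proof (rule poly_eqI_degree_lead_coeff)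
    show "degree P \<le> n"
      unfolding P_def
    proof (intro degree_sum_le[OF fin])
      fix p assume "p \<in> ?S"
      then have "p (Suc n) \<le> Suc n"
        using permutes_in_image[of p "{1..Suc n}" "Suc n"] by auto
      then show "degree (monom (?c p) (p (Suc n) - 1)) \<le> n"
        by (intro order.trans[OF degree_monom_le]) auto
    qed
    show "degree Q \<le> n"
      unfolding Q_def using degQ degree_smult_le by metis
    show "card (z ` {1..n}) \<ge> n"
      using inj by (simp add: card_image)
    \<comment> \<open>Only permutations with \<open>p (Suc n) = Suc n\<close> reach the exponent
      \<open>n\<close>. They are the permutations of \<open>{1..n}\<close>, with the same signs, so
      the top coefficient is the smaller alternating sum.\<close>
    have "coeff P n = (\<Sum>p\<in>?S. if p (Suc n) = Suc n then ?c p else 0)"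
      unfolding P_def coeff_sum
    proof (rule sum.cong[OF refl])
      fix p assume "p \<in> ?S"
      then have "p (Suc n) \<ge> 1"
        using permutes_in_image[of p "{1..Suc n}" "Suc n"] by auto
      then show "coeff (monom (?c p) (p (Suc n) - 1)) n = (if p (Suc n) = Suc n then ?c p else 0)"
        by auto
    qed
    also have "\<dots> = (\<Sum>p\<in>{p\<in>?S. p (Suc n) = Suc n}. ?c p)"
      by (rule sum.inter_filter[OF fin, symmetric])
    also have "{p\<in>?S. p (Suc n) = Suc n} = {p. p permutes {1..n}}"
    proof (intro equalityI subsetI)
      fix p assume p: "p \<in> {p\<in>?S. p (Suc n) = Suc n}"
      have "p permutes {1..n}"
        by (rule permutes_superset[of p "{1..Suc n}"]) (use p in \<open>auto simp: not_le le_Suc_eq\<close>)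
      then show "p \<in> {p. p permutes {1..n}}" by simp
    next
      fix p assume p: "p \<in> {p. p permutes {1..n}}"
      then show "p \<in> {p\<in>?S. p (Suc n) = Suc n}"
        by (auto intro: permutes_subset[of p "{1..n}"] simp: permutes_not_in)
    qed
    also have "(\<Sum>p | p permutes {1..n}. ?c p) = vandermonde_sum n z"
      by (simp add: vandermonde_sum_def)
    also have "lead_coeff (\<Prod>j=1..n. [:- z j, 1:]) = 1"
      by (subst lead_coeff_prod) simp
    then have "vandermonde_sum n z = coeff Q n"
      unfolding Q_def degQ by simp
    finally show "coeff P n = coeff Q n" .
  next
    fix t assume "t \<in> z ` {1..n}"
    then obtain a where a: "a \<in> {1..n}" "t = z a" by auto
    have "poly P t = 0"
      unfolding P_eval by (rule vandermonde_sum_eq_0[of a _ "Suc n"]) (use a in auto)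
    moreover have "poly Q t = 0"
      using a by (auto simp: Q_def poly_prod)
    ultimately show "poly P t = poly Q t" by simp
  qed
  then have "poly P (z (Suc n)) = poly Q (z (Suc n))" by simp
  then show ?thesis
    unfolding P_eval by (simp add: Q_def poly_prod fun_upd_triv)
qed

lemma prod_pairs_Suc:
  fixes f :: "nat \<Rightarrow> nat \<Rightarrow> 'a :: comm_monoid_mult"
  shows "(\<Prod>h=1..Suc n. \<Prod>t\<in>{h<..Suc n}. f h t) =
    (\<Prod>h=1..n. \<Prod>t\<in>{h<..n}. f h t) * (\<Prod>h=1..n. f h (Suc n))"
proof -
  have "(\<Prod>h=1..n. \<Prod>t\<in>{h<..Suc n}. f h t) = (\<Prod>h=1..n. (\<Prod>t\<in>{h<..n}. f h t) * f h (Suc n))"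
  proof (rule prod.cong[OF refl])
    fix h assume "h \<in> {1..n}"
    then have "{h<..Suc n} = insert (Suc n) {h<..n}" by auto
    then show "(\<Prod>t\<in>{h<..Suc n}. f h t) = (\<Prod>t\<in>{h<..n}. f h t) * f h (Suc n)"
      by (simp add: mult.commute)
  qed
  then show ?thesis by (simp add: prod.distrib)
qed

lemma vandermonde:
  fixes z :: "nat \<Rightarrow> 'a :: field_char_0"
  shows "vandermonde_sum n z = (\<Prod>h=1..n. \<Prod>t\<in>{h<..n}. z t - z h)"
proof (induction n)
  case 0
  then show ?case by (simp add: vandermonde_sum_def)
next
  case (Suc n)
  show ?case
  proof (cases "inj_on z {1..n}")
    case True
    then show ?thesis
      by (simp only: vandermonde_sum_Suc prod_pairs_Suc Suc)
  next
    \<comment> \<open>With a repeated node among the first \<open>n\<close> both sides vanish; this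
      covers the nodes for which the polynomial comparison has too few roots.\<close>
    case False
    then obtain a b where ab: "a \<in> {1..n}" "b \<in> {1..n}" "a < b" "z a = z b"
      unfolding inj_on_def by (metis linorder_neqE_nat)
    have "vandermonde_sum (Suc n) z = 0"
      by (rule vandermonde_sum_eq_0[of a _ b]) (use ab in auto)
    moreover have "(\<Prod>t\<in>{a<..Suc n}. z t - z a) = 0"
      using ab by (intro prod_zero bexI[of _ b]) auto
    then have "(\<Prod>h=1..Suc n. \<Prod>t\<in>{h<..Suc n}. z t - z h) = 0"
    proof (intro prod_zero[OF finite_atLeastAtMost])
      assume "(\<Prod>t\<in>{a<..Suc n}. z t - z a) = 0"
      then show "\<exists>h\<in>{1..Suc n}. (\<Prod>t\<in>{h<..Suc n}. z t - z h) = 0"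
        by (rule bexI) (use ab in auto)
    qed
    ultimately show ?thesis by simp
  qed
qed

text \<open>Every index lies in \<open>n - 1\<close> of the pairs. This collects the factors
  \<open>y h * y t\<close> that appear when each sine is written as a difference of squares.\<close>

lemma prod_pairs_mult:
  fixes y :: "nat \<Rightarrow> 'a :: comm_monoid_mult"
  shows "(\<Prod>h=1..n. \<Prod>t\<in>{h<..n}. y h * y t) = (\<Prod>h=1..n. y h ^ (n - 1))"
proof (induction n)
  case (Suc n)
  have "(\<Prod>h=1..Suc n. \<Prod>t\<in>{h<..Suc n}. y h * y t) =
      (\<Prod>h=1..n. y h ^ (n - 1)) * ((\<Prod>h=1..n. y h) * y (Suc n) ^ n)"
    by (simp only: prod_pairs_Suc Suc.IH) (simp add: prod.distrib)
  also have "\<dots> = (\<Prod>h=1..n. y h ^ (n - 1) * y h) * y (Suc n) ^ n"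
    by (simp add: prod.distrib mult.assoc)
  also have "(\<Prod>h=1..n. y h ^ (n - 1) * y h) = (\<Prod>h=1..n. y h ^ n)"
    by (intro prod.cong refl power_minus_mult) auto
  finally show ?case by simp
qed simp

subsection \<open>The product of sines as an eigenfunction\<close>

text \<open>Up to a nonzero constant, the Slater determinant of \<open>n\<close> plane waves (the
  Weyl denominator of type A).\<close>

definition sine_product :: "nat \<Rightarrow> nat \<Rightarrow> (nat \<Rightarrow> real) \<Rightarrow> real" where
  "sine_product n m x = (\<Prod>h=1..n. \<Prod>t\<in>{h<..n}. sin (pi * (x h - x t) / real m))"

text \<open>With \<open>y h = cis (pi * x h / real m)\<close>, each sine times
  \<open>- 2 * \<i> * (y h * y t)\<close> is \<open>(y t)\<^sup>2 - (y h)\<^sup>2\<close>, so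
  Vandermonde's formula applies to the squares. Dividing by the powers \<open>y h ^ (n - 1)\<close>
  centres the frequencies around 0.\<close>

lemma sine_product_expansion:
  fixes x :: "nat \<Rightarrow> real"
  shows "(\<Prod>h=1..n. \<Prod>t\<in>{h<..n}. - 2 * \<i>) * of_real (sine_product n m x) =
    (\<Sum>p | p permutes {1..n}. of_int (sign p) *
       (\<Prod>h=1..n. cis (pi * x h * (2 * real (p h) - real n - 1) / real m)))"
proof -
  define y where "y h = cis (pi * x h / real m)" for h
  have y_nz: "y h \<noteq> 0" for h by (simp add: y_def)
  have sub: "(y t)\<^sup>2 - (y h)\<^sup>2 = - 2 * \<i> * of_real (sin (pi * (x h - x t) / real m)) * (y h * y t)" for h t
  proof -
    have cis_diff: "cis a - cis (- a) = 2 * \<i> * of_real (sin a)" for a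
      by (simp add: complex_eq_iff)
    have "- 2 * \<i> * of_real (sin (pi * (x h - x t) / real m)) =
        cis (pi * x t / real m - pi * x h / real m) - cis (pi * x h / real m - pi * x t / real m)"
      using cis_diff[of "pi * (x h - x t) / real m"]
      by (simp add: diff_divide_distrib right_diff_distrib) (metis minus_diff_eq)
    also have "\<dots> = y t / y h - y h / y t"
      unfolding y_def by (simp add: cis_divide)
    finally show ?thesis
      using y_nz[of t] y_nz[of h] by (simp add: field_simps power2_eq_square)
  qed
  have "(\<Prod>h=1..n. \<Prod>t\<in>{h<..n}. - 2 * \<i>) * of_real (sine_product n m x) *
      (\<Prod>h=1..n. y h ^ (n - 1)) = (\<Prod>h=1..n. \<Prod>t\<in>{h<..n}. (y t)\<^sup>2 - (y h)\<^sup>2)"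
    unfolding sub prod.distrib prod_pairs_mult[symmetric] sine_product_def
    by (simp only: of_real_prod)
  also have "\<dots> = (\<Sum>p | p permutes {1..n}. of_int (sign p) * (\<Prod>h=1..n. (y h)\<^sup>2 ^ (p h - 1)))"
    by (simp only: vandermonde[symmetric] vandermonde_sum_def)
  finally have "(\<Prod>h=1..n. \<Prod>t\<in>{h<..n}. - 2 * \<i>) * of_real (sine_product n m x) =
      (\<Sum>p | p permutes {1..n}. of_int (sign p) * (\<Prod>h=1..n. (y h)\<^sup>2 ^ (p h - 1))) /
      (\<Prod>h=1..n. y h ^ (n - 1))"
    using y_nz by (simp add: field_simps)
  also have "\<dots> = (\<Sum>p | p permutes {1..n}. of_int (sign p) *
      (\<Prod>h=1..n. (y h)\<^sup>2 ^ (p h - 1) / y h ^ (n - 1)))"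
    by (simp add: sum_divide_distrib prod_dividef)
  also have "\<dots> = (\<Sum>p | p permutes {1..n}. of_int (sign p) *
       (\<Prod>h=1..n. cis (pi * x h * (2 * real (p h) - real n - 1) / real m)))"
  proof (intro sum.cong refl arg_cong2[of _ _ _ _ "(*)"] prod.cong)
    fix p h assume "p \<in> {p. p permutes {1..n}}" and h: "h \<in> {1..n}"
    then have ph: "p h \<ge> 1" using permutes_in_image[of p "{1..n}" h] by auto
    have "(y h)\<^sup>2 ^ (p h - 1) / y h ^ (n - 1) =
        cis (real (2 * (p h - 1)) * (pi * x h / real m) - real (n - 1) * (pi * x h / real m))"
      unfolding y_def by (simp only: power_mult[symmetric] DeMoivre cis_divide of_nat_mult) (simp add: mult_ac)
    also have "real (2 * (p h - 1)) * (pi * x h / real m) - real (n - 1) * (pi * x h / real m) =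
        pi * x h * (2 * real (p h) - real n - 1) / real m"
      using ph h by (simp add: of_nat_diff algebra_simps diff_divide_distrib add_divide_distrib)
    finally show "(y h)\<^sup>2 ^ (p h - 1) / y h ^ (n - 1) =
        cis (pi * x h * (2 * real (p h) - real n - 1) / real m)" .
  qed
  finally show ?thesis .
qed

lemma prod_cis: "(\<Prod>x\<in>A. cis (f x)) = cis (\<Sum>x\<in>A. f x)"
  by (induction A rule: infinite_finite_induct) (auto simp: cis_mult)

text \<open>By the half-angle formula \<open>cis (2 * b) + 1\<close> is \<open>2 * cos b\<close>
  times the phase \<open>cis b\<close>, and the phases cancel because the angles are symmetric
  around 0.\<close>

lemma prod_one_plus_cis:
  "(\<Prod>j=1..n. cis (pi * (2 * real j - real n - 1) / real m) + 1) =
   of_real (2 ^ n * (\<Prod>j=1..n. cos (pi * (real j - (real n + 1) / 2) / real m)))"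
proof -
  define a where "a j = pi * (real j - (real n + 1) / 2) / real m" for j
  have half: "cis (2 * b) + 1 = of_real (2 * cos b) * cis b" for b
    by (simp add: complex_eq_iff cos_double_cos sin_double power2_eq_square)
  have "(\<Sum>j=1..k. real j - c) = real k * (real k + 1) / 2 - real k * c" for k c
    by (induction k) (auto simp: field_simps)
  then have "(\<Sum>j=1..n. a j) = 0"
    by (simp add: a_def sum_divide_distrib[symmetric] sum_distrib_left[symmetric])
  have "pi * (2 * real j - real n - 1) / real m = 2 * a j" for j
  proof -
    have "2 * real j - real n - 1 = 2 * (real j - (real n + 1) / 2)" by (simp add: field_simps)
    then show ?thesis by (simp only: a_def) simp
  qed
  then have "(\<Prod>j=1..n. cis (pi * (2 * real j - real n - 1) / real m) + 1) =
      (\<Prod>j=1..n. of_real (2 * cos (a j)) * cis (a j))"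
    by (simp only: half)
  also have "\<dots> = (\<Prod>j=1..n. of_real (2 * cos (a j)))"
    using \<open>(\<Sum>j=1..n. a j) = 0\<close> by (simp only: prod.distrib prod_cis) simp
  finally show ?thesis
    by (simp add: prod.distrib a_def)
qed

text \<open>On a single plane wave the sum over \<open>J\<close> is the expansion of a product with
  one factor \<open>cis (\<theta> (p h)) + 1\<close> per coordinate. Permuting the frequencies only
  reorders the factors, hence the common eigenvalue.\<close>

lemma sine_product_step:
  "(\<Sum>J\<in>Pow {1..n}. sine_product n m (\<lambda>i. x i + of_bool (i \<in> J))) =
   2 ^ n * (\<Prod>j=1..n. cos (pi * (real j - (real n + 1) / 2) / real m)) * sine_product n m x"
proof -
  define c where "c = (\<Prod>h=1..n. \<Prod>t\<in>{h<..n}. - 2 * \<i>)"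
  define \<theta> where "\<theta> j = pi * (2 * real j - real n - 1) / real m" for j :: nat
  define P where "P = {p. p permutes {1..n}}"
  have c: "c \<noteq> 0" by (simp add: c_def)
  have expansion: "c * of_real (sine_product n m y) =
      (\<Sum>p\<in>P. of_int (sign p) * (\<Prod>h=1..n. cis (y h * \<theta> (p h))))" for y
    unfolding c_def sine_product_expansion P_def \<theta>_def by (simp add: mult_ac)
  have subsets: "(\<Sum>J\<in>Pow {1..n}. \<Prod>h=1..n. cis (of_bool (h \<in> J) * \<theta> (p h))) =
      of_real (2 ^ n * (\<Prod>j=1..n. cos (pi * (real j - (real n + 1) / 2) / real m)))"
    if "p \<in> P" for p
  proof -
    have p: "p permutes {1..n}" using that by (simp add: P_def)
    have "(\<Sum>J\<in>Pow {1..n}. \<Prod>h=1..n. cis (of_bool (h \<in> J) * \<theta> (p h))) =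
        (\<Sum>J\<in>Pow {1..n}. (\<Prod>h\<in>J. cis (\<theta> (p h))) * (\<Prod>h\<in>{1..n} - J. 1))"
    proof (rule sum.cong[OF refl])
      fix J assume "J \<in> Pow {1..n}"
      then have "(\<Prod>h=1..n. cis (of_bool (h \<in> J) * \<theta> (p h))) = (\<Prod>h\<in>J. cis (of_bool (h \<in> J) * \<theta> (p h)))"
        by (intro prod.mono_neutral_right) auto
      then show "(\<Prod>h=1..n. cis (of_bool (h \<in> J) * \<theta> (p h))) =
          (\<Prod>h\<in>J. cis (\<theta> (p h))) * (\<Prod>h\<in>{1..n} - J. 1)"
        by simp
    qed
    also have "\<dots> = (\<Prod>h=1..n. cis (\<theta> (p h)) + 1)"
      by (rule prod_add[symmetric]) simp
    also have "\<dots> = (\<Prod>j=1..n. cis (\<theta> j) + 1)"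
      using prod.permute[OF p, of "\<lambda>j. cis (\<theta> j) + 1"] by (simp add: o_def)
    finally show ?thesis
      unfolding \<theta>_def prod_one_plus_cis .
  qed
  have "c * of_real (\<Sum>J\<in>Pow {1..n}. sine_product n m (\<lambda>i. x i + of_bool (i \<in> J))) =
      (\<Sum>J\<in>Pow {1..n}. \<Sum>p\<in>P. of_int (sign p) * (\<Prod>h=1..n. cis (x h * \<theta> (p h))) *
        (\<Prod>h=1..n. cis (of_bool (h \<in> J) * \<theta> (p h))))"
    by (simp add: sum_distrib_left expansion distrib_right cis_mult[symmetric] prod.distrib mult.assoc)
  also have "\<dots> = (\<Sum>p\<in>P. \<Sum>J\<in>Pow {1..n}. of_int (sign p) * (\<Prod>h=1..n. cis (x h * \<theta> (p h))) *
        (\<Prod>h=1..n. cis (of_bool (h \<in> J) * \<theta> (p h))))"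
    by (rule sum.swap)
  also have "\<dots> = (\<Sum>p\<in>P. of_int (sign p) * (\<Prod>h=1..n. cis (x h * \<theta> (p h))) *
      of_real (2 ^ n * (\<Prod>j=1..n. cos (pi * (real j - (real n + 1) / 2) / real m))))"
    by (intro sum.cong refl) (simp only: sum_distrib_left[symmetric] subsets)
  also have "\<dots> = c * of_real (2 ^ n * (\<Prod>j=1..n. cos (pi * (real j - (real n + 1) / 2) / real m)) *
      sine_product n m x)"
    by (simp only: sum_distrib_right[symmetric] expansion[symmetric] of_real_mult) (simp only: mult_ac)
  finally show ?thesis
    by (simp only: mult_left_cancel[OF c] of_real_eq_iff)
qed

section \<open>Orthogonality of characters and the norm over all residue vectors\<close>

text \<open>A geometric sum of powers of an \<open>m\<close>-th root of unity; the bound on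
  \<open>d\<close> excludes the root 1 unless \<open>d = 0\<close>.\<close>

lemma sum_cis_orthogonal:
  fixes d :: int
  assumes "\<bar>d\<bar> < int m"
  shows "(\<Sum>a\<in>{0..<int m}. cis (2 * pi * of_int d * of_int a / real m)) = of_nat m * of_bool (d = 0)"
proof (cases "d = 0")
  case False
  define w where "w = cis (2 * pi * of_int d / real m)"
  have m: "m > 0" using assms by simp
  have "w \<noteq> 1"
  proof
    assume "w = 1"
    then have "cos (2 * pi * of_int d / real m) = 1" by (simp add: w_def complex_eq_iff)
    then obtain q :: int where "2 * pi * of_int d / real m = of_int q * 2 * pi"
      using cos_one_2pi_int by auto
    then have "real_of_int d = real_of_int (q * int m)" using m by (simp add: field_simps)
    then have "d = q * int m" by (simp only: of_int_eq_iff)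
    then have "int m dvd d" by simp
    then show False using assms False zdvd_imp_le[of "int m" "\<bar>d\<bar>"] by simp
  qed
  have "w ^ m = cis (2 * pi * of_int d)"
    using m by (simp add: w_def DeMoivre)
  then have "w ^ m = 1" by simp
  have "(\<Sum>a\<in>{0..<int m}. cis (2 * pi * of_int d * of_int a / real m)) = (\<Sum>a<m. w ^ a)"
    by (rule sum.reindex_bij_witness[of _ int nat]) (auto simp: w_def DeMoivre mult_ac)
  also have "\<dots> = 0"
    using \<open>w \<noteq> 1\<close> \<open>w ^ m = 1\<close> by (simp add: geometric_sum)
  finally show ?thesis using False by simp
qed simp

text \<open>The squared modulus of the expansion involves only differences of frequencies. These are
  integer multiples of \<open>2 * pi / real m\<close> even where the frequencies themselves are not,
  so they give characters modulo \<open>m\<close>. Only the \<open>fact n\<close> diagonal terms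
  \<open>p = q\<close> survive, each with value \<open>m ^ n\<close>.\<close>

lemma sum_sine_product_squared:
  assumes "n \<le> m"
  shows "(\<Sum>x\<in>{1..n} \<rightarrow>\<^sub>E {0..<int m}. (sine_product n m (\<lambda>i. of_int (x i)))\<^sup>2) * 2 ^ (n\<^sup>2 - n) =
    fact n * real m ^ n"
proof -
  define c where "c = (\<Prod>h=1..n. \<Prod>t\<in>{h<..n}. - 2 * \<i>)"
  define \<theta> where "\<theta> j = pi * (2 * real j - real n - 1) / real m" for j :: nat
  define P where "P = {p. p permutes {1..n}}"
  define X where "X = {1..n} \<rightarrow>\<^sub>E {0..<int m}"
  have finP: "finite P" by (simp add: P_def finite_permutations)
  have "(\<Prod>h=1..k. \<Prod>t\<in>{h<..k}. 4) = (2 :: complex) ^ (k\<^sup>2 - k)" for k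
  proof (induction k)
    case (Suc k)
    have "(Suc k)\<^sup>2 - Suc k = (k\<^sup>2 - k) + 2 * k"
      by (simp add: power2_eq_square)
    then show ?case
      by (simp only: prod_pairs_Suc Suc.IH) (simp add: power_add power_mult)
  qed simp
  moreover have "c * cnj c = (\<Prod>h=1..n. \<Prod>t\<in>{h<..n}. 4)"
    unfolding c_def cnj_prod prod.distrib[symmetric] by (intro prod.cong) auto
  ultimately have c: "c * cnj c = 2 ^ (n\<^sup>2 - n)" by simp
  have expansion: "c * of_real (sine_product n m y) =
      (\<Sum>p\<in>P. of_int (sign p) * (\<Prod>h=1..n. cis (y h * \<theta> (p h))))" for y
    unfolding c_def sine_product_expansion P_def \<theta>_def by (simp add: mult_ac)
  have square: "of_real ((sine_product n m y)\<^sup>2 * 2 ^ (n\<^sup>2 - n)) =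
      (\<Sum>p\<in>P. \<Sum>q\<in>P. of_int (sign p * sign q) *
        (\<Prod>h=1..n. cis (2 * pi * of_int (int (p h) - int (q h)) * y h / real m)))" for y
  proof -
    have cis: "cis (y h * \<theta> (p h)) * cis (- (y h * \<theta> (q h))) =
        cis (2 * pi * of_int (int (p h) - int (q h)) * y h / real m)" for p q h
      by (simp add: cis_mult \<theta>_def diff_divide_distrib add_divide_distrib algebra_simps)
    have "of_real ((sine_product n m y)\<^sup>2 * 2 ^ (n\<^sup>2 - n)) =
        (c * of_real (sine_product n m y)) * cnj (c * of_real (sine_product n m y))"
      using c by (simp add: power2_eq_square mult_ac)
    also have "\<dots> = (\<Sum>p\<in>P. \<Sum>q\<in>P. (of_int (sign p) * (\<Prod>h=1..n. cis (y h * \<theta> (p h)))) *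
        (of_int (sign q) * (\<Prod>h=1..n. cis (- (y h * \<theta> (q h))))))"
      unfolding expansion by (simp add: sum_product cis_cnj)
    also have "\<dots> = (\<Sum>p\<in>P. \<Sum>q\<in>P. of_int (sign p * sign q) *
        (\<Prod>h=1..n. cis (y h * \<theta> (p h)) * cis (- (y h * \<theta> (q h)))))"
      by (simp add: prod.distrib mult_ac)
    finally show ?thesis unfolding cis .
  qed
  have "complex_of_real (\<Sum>x\<in>X. (sine_product n m (\<lambda>i. of_int (x i)))\<^sup>2 * 2 ^ (n\<^sup>2 - n)) =
      (\<Sum>x\<in>X. \<Sum>p\<in>P. \<Sum>q\<in>P. of_int (sign p * sign q) *
        (\<Prod>h=1..n. cis (2 * pi * of_int (int (p h) - int (q h)) * of_int (x h) / real m)))"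
    by (simp only: of_real_sum square)
  also have "\<dots> = (\<Sum>p\<in>P. \<Sum>x\<in>X. \<Sum>q\<in>P. of_int (sign p * sign q) *
        (\<Prod>h=1..n. cis (2 * pi * of_int (int (p h) - int (q h)) * of_int (x h) / real m)))"
    by (rule sum.swap)
  also have "\<dots> = (\<Sum>p\<in>P. \<Sum>q\<in>P. \<Sum>x\<in>X. of_int (sign p * sign q) *
        (\<Prod>h=1..n. cis (2 * pi * of_int (int (p h) - int (q h)) * of_int (x h) / real m)))"
    by (intro sum.cong refl sum.swap)
  also have "\<dots> = (\<Sum>p\<in>P. \<Sum>q\<in>P. if p = q then of_nat m ^ n else 0)"
  proof (intro sum.cong refl)
    fix p q assume "p \<in> P" "q \<in> P"
    then have p: "p permutes {1..n}" and q: "q permutes {1..n}" by (auto simp: P_def)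
    have pq: "p h = q h" if "h \<notin> {1..n}" for h
      using p q that by (simp add: permutes_not_in)
    have "(\<Sum>x\<in>X. \<Prod>h=1..n. cis (2 * pi * of_int (int (p h) - int (q h)) * of_int (x h) / real m)) =
        (\<Prod>h=1..n. \<Sum>a\<in>{0..<int m}. cis (2 * pi * of_int (int (p h) - int (q h)) * of_int a / real m))"
      unfolding X_def by (rule prod_sum_PiE[symmetric]) auto
    also have "\<dots> = (\<Prod>h=1..n. of_nat m * of_bool (p h = q h))"
    proof (intro prod.cong refl)
      fix h assume h: "h \<in> {1..n}"
      have "p h \<in> {1..n}" "q h \<in> {1..n}"
        using permutes_in_image[OF p] permutes_in_image[OF q] h by blast+
      then have "\<bar>int (p h) - int (q h)\<bar> < int m" using assms by auto
      from sum_cis_orthogonal[OF this]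
      show "(\<Sum>a\<in>{0..<int m}. cis (2 * pi * of_int (int (p h) - int (q h)) * of_int a / real m)) =
          of_nat m * of_bool (p h = q h)"
        by simp
    qed
    also have "\<dots> = (if p = q then of_nat m ^ n else 0)"
    proof (cases "p = q")
      case False
      then obtain h where h: "p h \<noteq> q h" by auto
      with pq have "h \<in> {1..n}" by blast
      then have "(\<Prod>h=1..n. complex_of_nat m * of_bool (p h = q h)) = 0"
        using h by (intro prod_zero) auto
      with False show ?thesis by simp
    qed simp
    finally have *: "(\<Sum>x\<in>X. \<Prod>h=1..n. cis (2 * pi * of_int (int (p h) - int (q h)) * of_int (x h) / real m)) =
        (if p = q then of_nat m ^ n else 0)" .
    show "(\<Sum>x\<in>X. of_int (sign p * sign q) *
        (\<Prod>h=1..n. cis (2 * pi * of_int (int (p h) - int (q h)) * of_int (x h) / real m))) =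
        (if p = q then of_nat m ^ n else 0)"
      unfolding sum_distrib_left[symmetric] * by (simp add: sign_idempotent del: of_int_mult)
  qed
  also have "\<dots> = of_nat (card P) * of_nat m ^ n"
    using finP by simp
  also have "card P = fact n"
    unfolding P_def by (simp add: card_permutations)
  finally have "complex_of_real (\<Sum>x\<in>X. (sine_product n m (\<lambda>i. of_int (x i)))\<^sup>2 * 2 ^ (n\<^sup>2 - n)) =
      complex_of_real (fact n * real m ^ n)"
    by simp
  then show ?thesis
    unfolding of_real_eq_iff X_def by (simp add: sum_distrib_right)
qed

text \<open>In the plane-wave expansion, permuting the coordinates re-indexes the sum over
  permutations; from the product of sines one would have to count the reversed pairs.\<close>

lemma sine_product_permute:
  assumes p: "p permutes {1..n}"
  shows "sine_product n m (\<lambda>i. x (p i)) = of_int (sign p) * sine_product n m x"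
proof -
  define c where "c = (\<Prod>h=1..n. \<Prod>t\<in>{h<..n}. - 2 * \<i>)"
  define \<theta> where "\<theta> j = pi * (2 * real j - real n - 1) / real m" for j :: nat
  have c: "c \<noteq> 0" by (simp add: c_def)
  have expansion: "c * of_real (sine_product n m y) =
      (\<Sum>q | q permutes {1..n}. of_int (sign q) * (\<Prod>h=1..n. cis (y h * \<theta> (q h))))" for y
    unfolding c_def sine_product_expansion \<theta>_def by (simp add: mult_ac)
  have "c * of_real (sine_product n m (\<lambda>i. x (p i))) =
      (\<Sum>q | q permutes {1..n}. of_int (sign (q \<circ> p)) * (\<Prod>h=1..n. cis (x (p h) * \<theta> ((q \<circ> p) h))))"
    unfolding expansion by (rule sum_permutations_compose_right[OF p])
  also have "\<dots> = (\<Sum>q | q permutes {1..n}.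
      of_int (sign p) * (of_int (sign q) * (\<Prod>h=1..n. cis (x h * \<theta> (q h)))))"
  proof (rule sum.cong[OF refl])
    fix q assume "q \<in> {q. q permutes {1..n}}"
    then have "sign (q \<circ> p) = sign q * sign p"
      using p by (intro sign_compose) (auto intro: permutes_imp_permutation)
    then show "of_int (sign (q \<circ> p)) * (\<Prod>h=1..n. cis (x (p h) * \<theta> ((q \<circ> p) h))) =
        of_int (sign p) * (of_int (sign q) * (\<Prod>h=1..n. cis (x h * \<theta> (q h))))"
      using prod.permute[OF p, of "\<lambda>h. cis (x h * \<theta> (q h))"] by (simp add: o_def)
  qed
  also have "\<dots> = c * of_real (of_int (sign p) * sine_product n m x)"
    by (simp only: sum_distrib_left[symmetric] expansion[symmetric]) simp
  finally show ?thesis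
    by (simp only: mult_left_cancel[OF c] of_real_eq_iff)
qed

subsection \<open>Powers of matrices with a positive eigenvector\<close>

text \<open>On \<open>S\<close> this is the entry of the \<open>k\<close>-th matrix power. The
  recursion splits off the last step, as the recursion for the number of walks will do.\<close>

primrec walk_weight :: "'a set \<Rightarrow> ('a \<Rightarrow> 'a \<Rightarrow> real) \<Rightarrow> nat \<Rightarrow> 'a \<Rightarrow> 'a \<Rightarrow> real" where
  "walk_weight S A 0 x y = of_bool (x = y)"
| "walk_weight S A (Suc k) x y = (\<Sum>z\<in>S. walk_weight S A k x z * A z y)"

lemma walk_weight_add:
  assumes "finite S" "y \<in> S"
  shows "walk_weight S A (k + l) x y = (\<Sum>z\<in>S. walk_weight S A k x z * walk_weight S A l z y)"
  using assms(2)
proof (induction l arbitrary: y)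
  case 0
  then show ?case using assms(1) by (simp add: of_bool_def if_distrib sum.delta' cong: if_cong)
next
  case (Suc l)
  have "walk_weight S A (k + Suc l) x y =
      (\<Sum>w\<in>S. (\<Sum>z\<in>S. walk_weight S A k x z * walk_weight S A l z w) * A w y)"
    by (simp add: Suc.IH)
  also have "\<dots> = (\<Sum>w\<in>S. \<Sum>z\<in>S. walk_weight S A k x z * (walk_weight S A l z w * A w y))"
    by (simp add: sum_distrib_right mult.assoc)
  also have "\<dots> = (\<Sum>z\<in>S. \<Sum>w\<in>S. walk_weight S A k x z * (walk_weight S A l z w * A w y))"
    by (rule sum.swap)
  finally show ?case by (simp add: sum_distrib_left)
qed

text \<open>One vector \<open>h\<close> is a left and a right eigenvector, so it alone determines
  the rank-one limit of the normalised powers. The assumption \<open>primitive\<close> rules out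
  oscillation in the length.\<close>

locale perron_eigenvector =
  fixes S :: "'a set" and A :: "'a \<Rightarrow> 'a \<Rightarrow> real" and h :: "'a \<Rightarrow> real" and \<rho> :: real
  assumes finite: "finite S"
    and nonneg: "\<And>x y. x \<in> S \<Longrightarrow> y \<in> S \<Longrightarrow> A x y \<ge> 0"
    and h_pos: "\<And>x. x \<in> S \<Longrightarrow> h x > 0"
    and rho_pos: "\<rho> > 0"
    and right: "\<And>x. x \<in> S \<Longrightarrow> (\<Sum>y\<in>S. A x y * h y) = \<rho> * h x"
    and left: "\<And>y. y \<in> S \<Longrightarrow> (\<Sum>x\<in>S. h x * A x y) = \<rho> * h y"
    and primitive: "\<exists>N. \<forall>x\<in>S. \<forall>y\<in>S. walk_weight S A N x y > 0"
begin

lemma walk_weight_nonneg: "x \<in> S \<Longrightarrow> y \<in> S \<Longrightarrow> walk_weight S A k x y \<ge> 0"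
  by (induction k arbitrary: y) (auto intro!: sum_nonneg mult_nonneg_nonneg nonneg)

lemma walk_weight_right:
  assumes "x \<in> S"
  shows "(\<Sum>y\<in>S. walk_weight S A k x y * h y) = \<rho> ^ k * h x"
proof (induction k)
  case 0
  have "(\<Sum>y\<in>S. walk_weight S A 0 x y * h y) = (\<Sum>y\<in>S. if x = y then h y else 0)"
    by (intro sum.cong) auto
  then show ?case using assms finite by simp
next
  case (Suc k)
  have "(\<Sum>y\<in>S. walk_weight S A (Suc k) x y * h y) =
      (\<Sum>y\<in>S. \<Sum>z\<in>S. walk_weight S A k x z * (A z y * h y))"
    by (simp add: sum_distrib_right mult.assoc)
  also have "\<dots> = (\<Sum>z\<in>S. \<Sum>y\<in>S. walk_weight S A k x z * (A z y * h y))"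
    by (rule sum.swap)
  also have "\<dots> = (\<Sum>z\<in>S. walk_weight S A k x z * (\<rho> * h z))"
    by (intro sum.cong) (simp_all add: sum_distrib_left[symmetric] right)
  also have "\<dots> = \<rho> * (\<Sum>z\<in>S. walk_weight S A k x z * h z)"
    by (simp add: sum_distrib_left mult_ac)
  finally show ?case by (simp add: Suc.IH)
qed

lemma walk_weight_left:
  assumes "y \<in> S"
  shows "(\<Sum>x\<in>S. h x * walk_weight S A k x y) = \<rho> ^ k * h y"
  using assms
proof (induction k arbitrary: y)
  case 0
  have "(\<Sum>x\<in>S. h x * walk_weight S A 0 x y) = (\<Sum>x\<in>S. if x = y then h x else 0)"
    by (intro sum.cong) auto
  then show ?case using 0 finite by simp
next
  case (Suc k)
  have "(\<Sum>x\<in>S. h x * walk_weight S A (Suc k) x y) =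
      (\<Sum>x\<in>S. \<Sum>z\<in>S. h x * walk_weight S A k x z * A z y)"
    by (simp add: sum_distrib_left mult.assoc)
  also have "\<dots> = (\<Sum>z\<in>S. \<Sum>x\<in>S. h x * walk_weight S A k x z * A z y)"
    by (rule sum.swap)
  also have "\<dots> = (\<Sum>z\<in>S. \<rho> ^ k * h z * A z y)"
    by (intro sum.cong) (simp_all add: sum_distrib_right[symmetric] Suc.IH)
  also have "\<dots> = \<rho> ^ k * (\<Sum>z\<in>S. h z * A z y)"
    by (simp add: sum_distrib_left mult.assoc)
  finally show ?case using left[OF Suc.prems] by simp
qed

text \<open>Normalised so that the limit depends on neither \<open>x\<close> nor
  \<open>y\<close>.\<close>

definition ratio :: "nat \<Rightarrow> 'a \<Rightarrow> 'a \<Rightarrow> real" where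
  "ratio k x y = walk_weight S A k x y / (\<rho> ^ k * h x * h y)"

text \<open>The \<open>l\<close>-step kernel of the Doob transform of \<open>A\<close> by
  \<open>h\<close>, a stochastic matrix.\<close>

definition weight :: "nat \<Rightarrow> 'a \<Rightarrow> 'a \<Rightarrow> real" where
  "weight l x z = walk_weight S A l x z * h z / (\<rho> ^ l * h x)"

lemma weight_nonneg: "x \<in> S \<Longrightarrow> z \<in> S \<Longrightarrow> weight l x z \<ge> 0"
  unfolding weight_def using h_pos rho_pos walk_weight_nonneg
  by (simp add: less_imp_le)

lemma sum_weight: "x \<in> S \<Longrightarrow> (\<Sum>z\<in>S. weight l x z) = 1"
  unfolding weight_def sum_divide_distrib[symmetric] using h_pos[of x] rho_pos
  by (simp add: walk_weight_right)

lemma ratio_add: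
  assumes "x \<in> S" "y \<in> S"
  shows "ratio (l + k) x y = (\<Sum>z\<in>S. weight l x z * ratio k z y)"
proof -
  have "ratio (l + k) x y =
      (\<Sum>z\<in>S. walk_weight S A l x z * walk_weight S A k z y / (\<rho> ^ (l + k) * h x * h y))"
    unfolding ratio_def walk_weight_add[OF finite assms(2)] by (rule sum_divide_distrib)
  also have "\<dots> = (\<Sum>z\<in>S. weight l x z * ratio k z y)"
    by (intro sum.cong) (use h_pos rho_pos in \<open>auto simp: weight_def ratio_def power_add field_simps less_imp_neq[OF h_pos, symmetric]\<close>)
  finally show ?thesis .
qed

lemma tendsto_ratio:
  assumes "S \<noteq> {}" "x \<in> S" "y \<in> S"
  shows "(\<lambda>k. ratio k x y) \<longlonglongrightarrow> 1 / (\<Sum>z\<in>S. (h z)\<^sup>2)"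
proof -
  \<comment> \<open>\<open>ratio (l + k) x y\<close> is an average over \<open>z\<close> of \<open>ratio k z y\<close>; for \<open>l = N\<close> all weights are at least
    \<open>\<delta> > 0\<close>, so the oscillation \<open>hi - lo\<close> shrinks by the factor \<open>1 - \<delta>\<close>.\<close>
  define hi where "hi k = Max ((\<lambda>z. ratio k z y) ` S)" for k
  define lo where "lo k = Min ((\<lambda>z. ratio k z y) ` S)" for k
  have hi: "ratio k z y \<le> hi k" and lo: "lo k \<le> ratio k z y" if "z \<in> S" for k z
    using finite that by (auto simp: hi_def lo_def)
  have lo_le_hi: "lo k \<le> hi k" for k
    using hi[OF assms(2)] lo[OF assms(2)] order.trans by blast
  obtain N where N: "\<And>x z. x \<in> S \<Longrightarrow> z \<in> S \<Longrightarrow> walk_weight S A N x z > 0"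
    using primitive by blast
  define \<delta> where "\<delta> = Min ((\<lambda>(x, z). weight N x z) ` (S \<times> S))"
  have delta_le: "\<delta> \<le> weight N x z" if "x \<in> S" "z \<in> S" for x z
    unfolding \<delta>_def using finite that by (intro Min_le) auto
  have "\<delta> > 0"
    unfolding \<delta>_def using finite assms(1) h_pos rho_pos N by (subst Min_gr_iff) (auto simp: weight_def)
  \<comment> \<open>A weight of at least \<open>d\<close> at \<open>w\<close> pulls the average
    below the maximum by \<open>d\<close> times the gap at \<open>w\<close>. Taking
    \<open>d = 0\<close> yields monotonicity of \<open>hi\<close>; taking
    \<open>d = \<delta>\<close> at a minimiser yields the contraction.\<close>
  have avg_le: "ratio (l + k) x y \<le> hi k - d * (hi k - ratio k w y)"
    if "x \<in> S" "w \<in> S" "d \<le> weight l x w" for l k x w d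
  proof -
    have eq: "hi k - ratio (l + k) x y = (\<Sum>z\<in>S. weight l x z * (hi k - ratio k z y))"
      by (simp add: right_diff_distrib sum_subtractf ratio_add that assms sum_distrib_right[symmetric] sum_weight)
    have "weight l x w * (hi k - ratio k w y) \<le> hi k - ratio (l + k) x y"
      unfolding eq using that finite
      by (intro member_le_sum; auto intro!: mult_nonneg_nonneg weight_nonneg hi)
    moreover have "d * (hi k - ratio k w y) \<le> weight l x w * (hi k - ratio k w y)"
      using that hi by (intro mult_right_mono) auto
    ultimately show ?thesis by linarith
  qed
  have avg_ge: "ratio (l + k) x y \<ge> lo k" if "x \<in> S" for l k x
  proof -
    have "ratio (l + k) x y - lo k = (\<Sum>z\<in>S. weight l x z * (ratio k z y - lo k))"
      by (simp add: right_diff_distrib sum_subtractf ratio_add that assms sum_distrib_right[symmetric] sum_weight)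
    also have "\<dots> \<ge> 0"
      using that by (intro sum_nonneg mult_nonneg_nonneg weight_nonneg) (auto simp: lo)
    finally show ?thesis by simp
  qed
  have lo_mono: "lo k \<le> lo (l + k)" for l k
    unfolding lo_def[of "l + k"] using finite assms(1) avg_ge by (subst Min_ge_iff) auto
  have hi_mono: "hi (l + k) \<le> hi k" for l k
    unfolding hi_def[of "l + k"] using finite assms avg_le[of _ x 0 l k]
    by (subst Max_le_iff) (auto simp: weight_nonneg)
  have contract: "hi (N + k) \<le> hi k - \<delta> * (hi k - lo k)" for k
  proof -
    have "lo k \<in> (\<lambda>z. ratio k z y) ` S"
      unfolding lo_def using finite assms(1) by (intro Min_in) auto
    then obtain w where w: "w \<in> S" "ratio k w y = lo k" by auto
    show ?thesis
      unfolding hi_def[of "N + k"]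
      using finite assms(1) avg_le[OF _ w(1), of _ \<delta> N k] w delta_le by (subst Max_le_iff) auto
  qed
  have "incseq lo" "decseq hi"
    using lo_mono[of _ 1] hi_mono[of 1] by (auto simp: incseq_Suc_iff decseq_Suc_iff lo_mono[of _ 1, simplified])
  have "lo k \<le> hi 0" "lo 0 \<le> hi k" for k
    using lo_mono[of 0 k] hi_mono[of k 0] lo_le_hi[of k] by auto
  obtain a where a: "lo \<longlonglongrightarrow> a"
    using incseq_convergent[OF \<open>incseq lo\<close>] \<open>\<And>k. lo k \<le> hi 0\<close> by metis
  obtain b where b: "hi \<longlonglongrightarrow> b"
    using decseq_convergent[OF \<open>decseq hi\<close>] \<open>\<And>k. lo 0 \<le> hi k\<close> by metis
  \<comment> \<open>Both bounds are monotone and bounded, hence convergent, so the contraction can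
    be passed to the limit in place of an estimate of the rate.\<close>
  have "b \<le> b - \<delta> * (b - a)"
  proof (rule LIMSEQ_le)
    show "(\<lambda>k. hi (k + N)) \<longlonglongrightarrow> b" by (rule LIMSEQ_ignore_initial_segment[OF b])
    show "(\<lambda>k. hi k - \<delta> * (hi k - lo k)) \<longlonglongrightarrow> b - \<delta> * (b - a)"
      by (intro tendsto_intros a b)
    show "\<exists>K. \<forall>k\<ge>K. hi (k + N) \<le> hi k - \<delta> * (hi k - lo k)"
      using contract by (auto simp: add.commute)
  qed
  then have "\<delta> * (b - a) \<le> 0" by simp
  then have "b \<le> a" using \<open>\<delta> > 0\<close> by (simp add: mult_le_0_iff)
  moreover have "a \<le> b" by (rule LIMSEQ_le[OF a b]) (auto intro: lo_le_hi)
  ultimately have "a = b" by simp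
  have lim: "(\<lambda>k. ratio k z y) \<longlonglongrightarrow> a" if "z \<in> S" for z
    by (rule tendsto_sandwich[OF _ _ a]) (use b \<open>a = b\<close> that hi lo in auto)
  \<comment> \<open>The squares of \<open>h\<close> are proportional to the stationary distribution
    of the Doob transform, so this average is constant in \<open>k\<close>; it identifies the common
    limit.\<close>
  have "(\<Sum>z\<in>S. (h z)\<^sup>2 * ratio k z y) = 1" for k
  proof -
    have "(\<Sum>z\<in>S. (h z)\<^sup>2 * ratio k z y) = (\<Sum>z\<in>S. h z * walk_weight S A k z y / (\<rho> ^ k * h y))"
      by (intro sum.cong) (auto simp: ratio_def power2_eq_square less_imp_neq[OF h_pos, symmetric])
    also have "\<dots> = 1"
      unfolding sum_divide_distrib[symmetric] walk_weight_left[OF assms(3)]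
      using h_pos[OF assms(3)] rho_pos by simp
    finally show ?thesis .
  qed
  moreover have "(\<lambda>k. \<Sum>z\<in>S. (h z)\<^sup>2 * ratio k z y) \<longlonglongrightarrow> (\<Sum>z\<in>S. (h z)\<^sup>2 * a)"
    by (intro tendsto_sum tendsto_mult tendsto_const lim)
  ultimately have "(\<Sum>z\<in>S. (h z)\<^sup>2 * a) = 1"
    by (simp add: LIMSEQ_const_iff)
  then have "(\<Sum>z\<in>S. (h z)\<^sup>2) * a = 1"
    by (simp add: sum_distrib_right)
  then have "a = 1 / (\<Sum>z\<in>S. (h z)\<^sup>2)"
    by (metis nonzero_eq_divide_eq mult.commute mult_zero_left zero_neq_one)
  with lim[OF assms(2)] show ?thesis by simp
qed

end

subsection \<open>The transfer matrix on the circle\<close>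

text \<open>Restricting to \<open>{1..n}\<close> makes congruent vectors equal as functions, so that
  configurations form a finite set.\<close>

definition residues :: "nat \<Rightarrow> nat \<Rightarrow> (nat \<Rightarrow> int) \<Rightarrow> nat \<Rightarrow> int" where
  "residues n m X = (\<lambda>j\<in>{1..n}. X j mod int m)"

definition alcove :: "nat \<Rightarrow> nat \<Rightarrow> (nat \<Rightarrow> int) set" where
  "alcove n m = {X. \<forall>i\<in>{1..n}. \<forall>j\<in>{1..n}. i < j \<longrightarrow> X j < X i \<and> X i < X j + int m}"

text \<open>A step changes differences of coordinates by at most 1, so from the alcove it ends here:
  it can hit a wall but not cross it.\<close>

definition closed_alcove :: "nat \<Rightarrow> nat \<Rightarrow> (nat \<Rightarrow> int) set" where
  "closed_alcove n m = {X. \<forall>i\<in>{1..n}. \<forall>j\<in>{1..n}. i < j \<longrightarrow> X j \<le> X i \<and> X i \<le> X j + int m}"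

definition configs :: "nat \<Rightarrow> nat \<Rightarrow> (nat \<Rightarrow> int) set" where
  "configs n m = residues n m ` alcove n m"

text \<open>Counting step sets, instead of testing reachability, keeps multiplicities: for
  \<open>m = 1\<close> different \<open>J\<close> lead to the same residue vector, while the walks
  distinguish them.\<close>

definition transfer_matrix :: "nat \<Rightarrow> nat \<Rightarrow> (nat \<Rightarrow> int) \<Rightarrow> (nat \<Rightarrow> int) \<Rightarrow> real" where
  "transfer_matrix n m x y =
     real (card {J \<in> Pow {1..n}. residues n m (\<lambda>j. x j + of_bool (j \<in> J)) = y})"

text \<open>Adding \<open>m\<close> to one coordinate flips the sign of \<open>n - 1\<close> sines,
  so it is the absolute value that is a function of the residues.\<close>

definition ground_state :: "nat \<Rightarrow> nat \<Rightarrow> (nat \<Rightarrow> int) \<Rightarrow> real" where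
  "ground_state n m X = \<bar>sine_product n m (\<lambda>i. of_int (X i))\<bar>"

lemma transfer_nonneg: "transfer_matrix n m x y \<ge> 0"
  by (simp add: transfer_matrix_def)

lemma alcoveD:
  "X \<in> alcove n m \<Longrightarrow> i \<in> {1..n} \<Longrightarrow> j \<in> {1..n} \<Longrightarrow> i < j \<Longrightarrow> X j < X i \<and> X i < X j + int m"
  by (auto simp: alcove_def)

lemma closed_alcoveD:
  "X \<in> closed_alcove n m \<Longrightarrow> i \<in> {1..n} \<Longrightarrow> j \<in> {1..n} \<Longrightarrow> i < j \<Longrightarrow> X j \<le> X i \<and> X i \<le> X j + int m"
  by (auto simp: closed_alcove_def)

lemma residues_eq_iff:
  "residues n m X = residues n m Y \<longleftrightarrow> (\<forall>j\<in>{1..n}. X j mod int m = Y j mod int m)"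
  by (auto simp: residues_def fun_eq_iff restrict_def)

lemma residues_residues_add:
  "residues n m (\<lambda>j. residues n m X j + f j) = residues n m (\<lambda>j. X j + f j)"
  by (auto simp: residues_eq_iff residues_def mod_simps)

lemma residues_residues_diff:
  "residues n m (\<lambda>j. residues n m X j - f j) = residues n m (\<lambda>j. X j - f j)"
  by (auto simp: residues_eq_iff residues_def mod_simps)

lemma residues_residues: "residues n m (residues n m X) = residues n m X"
  by (auto simp: residues_eq_iff residues_def)

lemma residues_configs: "x \<in> configs n m \<Longrightarrow> residues n m x = x"
  by (auto simp: configs_def residues_residues)

lemma configs_subset: "m > 0 \<Longrightarrow> configs n m \<subseteq> {1..n} \<rightarrow>\<^sub>E {0..<int m}"
  by (auto simp: configs_def residues_def)

lemma finite_configs: "m > 0 \<Longrightarrow> finite (configs n m)"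
  by (rule finite_subset[OF configs_subset]) (auto intro: finite_PiE)

section \<open>The ground state on residues: periodicity, positivity, zeros on the walls\<close>

lemma abs_sin_add_int_pi: "\<bar>sin (x + pi * of_int c)\<bar> = \<bar>sin x\<bar>"
proof -
  have s: "sin (pi * of_int c) = 0"
    by (metis Ints_of_int mult.commute sin_times_pi_eq_0)
  then have "\<bar>cos (pi * of_int c)\<bar> = 1"
    using sin_cos_squared_add[of "pi * of_int c"] by (auto simp: power2_eq_1_iff)
  with s show ?thesis by (simp add: sin_add abs_mult)
qed

lemma ground_state_cong:
  assumes "m > 0" "residues n m X = residues n m Y"
  shows "ground_state n m X = ground_state n m Y"
  unfolding ground_state_def sine_product_def abs_prod
proof (intro prod.cong refl)
  fix h t assume ht: "h \<in> {1..n}" "t \<in> {h<..n}"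
  have "X h mod int m = Y h mod int m" "X t mod int m = Y t mod int m"
    using assms(2) ht by (auto simp: residues_eq_iff)
  then have "(X h - X t) mod int m = (Y h - Y t) mod int m"
    by (metis mod_diff_cong)
  then have "int m dvd (X h - X t) - (Y h - Y t)"
    by (rule mod_eq_dvd_iff[THEN iffD1])
  then obtain c where "(X h - X t) - (Y h - Y t) = int m * c"
    by (elim dvdE)
  then have "X h - X t = (Y h - Y t) + int m * c" by simp
  then have "real_of_int (X h) - of_int (X t) = of_int (Y h) - of_int (Y t) + real m * of_int c"
    by (metis of_int_add of_int_diff of_int_mult of_int_of_nat_eq)
  then have "pi * (of_int (X h) - of_int (X t)) / real m =
      pi * (of_int (Y h) - of_int (Y t)) / real m + pi * of_int c"
    using assms(1) by (simp add: distrib_left add_divide_distrib)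
  then show "\<bar>sin (pi * (of_int (X h) - of_int (X t)) / real m)\<bar> =
      \<bar>sin (pi * (of_int (Y h) - of_int (Y t)) / real m)\<bar>"
    using abs_sin_add_int_pi by simp
qed

lemma sine_product_alcove_pos:
  assumes "X \<in> alcove n m"
  shows "sine_product n m (\<lambda>i. of_int (X i)) > 0"
  unfolding sine_product_def
proof (intro prod_pos sin_gt_zero)
  fix h t assume "h \<in> {1..n}" "t \<in> {h<..n}"
  then have *: "X t < X h \<and> X h < X t + int m"
    using alcoveD[OF assms, of h t] by auto
  then have **: "real_of_int (X t) < of_int (X h)" "real_of_int (X h) < of_int (X t) + real m"
    by linarith+
  then have "m > 0" by linarith
  with ** show "0 < pi * (of_int (X h) - of_int (X t)) / real m" by simp
  from ** \<open>m > 0\<close> show "pi * (of_int (X h) - of_int (X t)) / real m < pi"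
    by (simp add: pos_divide_less_eq)
qed

lemma sine_product_closed_alcove_nonneg:
  assumes "X \<in> closed_alcove n m"
  shows "sine_product n m (\<lambda>i. of_int (X i)) \<ge> 0"
  unfolding sine_product_def
proof (intro prod_nonneg ballI sin_ge_zero)
  fix h t assume "h \<in> {1..n}" "t \<in> {h<..n}"
  then have *: "X t \<le> X h \<and> X h \<le> X t + int m"
    using closed_alcoveD[OF assms, of h t] by auto
  then have **: "real_of_int (X t) \<le> of_int (X h)" "real_of_int (X h) \<le> of_int (X t) + real m"
    by linarith+
  then show "0 \<le> pi * (of_int (X h) - of_int (X t)) / real m" by simp
  from ** show "pi * (of_int (X h) - of_int (X t)) / real m \<le> pi"
    by (cases "m = 0") (auto simp: pos_divide_le_eq)
qed

lemma closed_alcove_incongruent: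
  assumes "X \<in> closed_alcove n m"
    and "\<And>h t. h \<in> {1..n} \<Longrightarrow> t \<in> {1..n} \<Longrightarrow> h < t \<Longrightarrow> X h mod int m \<noteq> X t mod int m"
  shows "X \<in> alcove n m"
proof -
  have "X j < X i \<and> X i < X j + int m" if "i \<in> {1..n}" "j \<in> {1..n}" "i < j" for i j
  proof -
    have "X i \<noteq> X j" "X i \<noteq> X j + int m"
      using assms(2)[OF that] by auto
    then show ?thesis using closed_alcoveD[OF assms(1) that] by linarith
  qed
  then show ?thesis by (auto simp: alcove_def)
qed

lemma ground_state_eq_0:
  assumes "m > 0" "h \<in> {1..n}" "t \<in> {1..n}" "h < t" "X h mod int m = X t mod int m"
  shows "ground_state n m X = 0"
proof -
  have "ground_state n m X = ground_state n m (residues n m X)"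
    using assms(1) by (intro ground_state_cong) (simp_all add: residues_residues)
  also have "(\<Prod>s\<in>{h<..n}. sin (pi * (of_int (residues n m X h) - of_int (residues n m X s)) / real m)) = 0"
    using assms by (intro prod_zero bexI[of _ t]) (auto simp: residues_def)
  then have "sine_product n m (\<lambda>i. of_int (residues n m X i)) = 0"
    unfolding sine_product_def using assms by (intro prod_zero[OF finite_atLeastAtMost] bexI[of _ h])
  then have "ground_state n m (residues n m X) = 0"
    by (simp add: ground_state_def)
  finally show ?thesis .
qed

lemma ground_state_configs_pos:
  assumes "m > 0" "x \<in> configs n m"
  shows "ground_state n m x > 0"
proof -
  obtain X where X: "X \<in> alcove n m" "x = residues n m X"
    using assms(2) by (auto simp: configs_def)
  then have "ground_state n m x = ground_state n m X"
    using assms(1) by (intro ground_state_cong) (simp_all add: residues_residues)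
  with sine_product_alcove_pos[OF X(1)] show ?thesis
    by (simp add: ground_state_def)
qed

text \<open>The ground state serves as a detector: it is positive on configurations and 0 as soon as
  two coordinates agree modulo \<open>m\<close>.\<close>

lemma residues_in_configs_incongruent:
  assumes "m > 0" "residues n m X \<in> configs n m" "h \<in> {1..n}" "t \<in> {1..n}" "h \<noteq> t"
  shows "X h mod int m \<noteq> X t mod int m"
proof -
  have "ground_state n m X \<noteq> 0"
    using ground_state_configs_pos[OF assms(1,2)] assms(1)
      ground_state_cong[of m n "residues n m X" X] by (simp add: residues_residues)
  then show ?thesis
    using ground_state_eq_0[OF assms(1), of h n t X] ground_state_eq_0[OF assms(1), of t n h X] assms
    by (metis linorder_neqE_nat)
qed

lemma alcove_shift_up: "X \<in> alcove n m \<Longrightarrow> (\<lambda>j. X j + of_bool (j \<in> J)) \<in> closed_alcove n m"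
  by (fastforce simp: alcove_def closed_alcove_def of_bool_def)

lemma alcove_shift_down: "X \<in> alcove n m \<Longrightarrow> (\<lambda>j. X j - of_bool (j \<in> J)) \<in> closed_alcove n m"
  by (fastforce simp: alcove_def closed_alcove_def of_bool_def)

text \<open>This lets the eigenvalue equation for free steps survive the walls: a step onto a wall
  is dropped from the sum over configurations, but its sine product is 0 anyway, and elsewhere in
  the closed alcove the sign is positive, so the absolute value changes nothing.\<close>

lemma closed_alcove_ground_state:
  assumes "m > 0" "X \<in> closed_alcove n m"
  shows "(if residues n m X \<in> configs n m then ground_state n m (residues n m X) else 0) =
    sine_product n m (\<lambda>i. of_int (X i))"
proof -
  have g: "ground_state n m (residues n m X) = sine_product n m (\<lambda>i. of_int (X i))"
    using ground_state_cong[OF assms(1), of n "residues n m X" X]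
      sine_product_closed_alcove_nonneg[OF assms(2)]
    by (simp add: residues_residues ground_state_def)
  show ?thesis
  proof (cases "X \<in> alcove n m")
    case True
    then show ?thesis using g by (auto simp: configs_def)
  next
    case False
    then obtain h t where "h \<in> {1..n}" "t \<in> {1..n}" "h < t" "X h mod int m = X t mod int m"
      using closed_alcove_incongruent[OF assms(2)] by blast
    then have "ground_state n m X = 0"
      by (rule ground_state_eq_0[OF assms(1)])
    then show ?thesis using g by (auto simp: ground_state_def)
  qed
qed

lemma sum_card_fibres:
  fixes f :: "'b \<Rightarrow> real"
  assumes "finite P" "finite C"
  shows "(\<Sum>y\<in>C. real (card {J \<in> P. g J = y}) * f y) = (\<Sum>J\<in>P. if g J \<in> C then f (g J) else 0)"
proof -
  have "(\<Sum>y\<in>C. real (card {J \<in> P. g J = y}) * f y) = (\<Sum>y\<in>C. \<Sum>J\<in>P. if g J = y then f y else 0)"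
    using assms by (intro sum.cong refl) (simp add: sum.inter_filter[symmetric])
  also have "\<dots> = (\<Sum>J\<in>P. \<Sum>y\<in>C. if g J = y then f y else 0)"
    by (rule sum.swap)
  also have "\<dots> = (\<Sum>J\<in>P. if g J \<in> C then f (g J) else 0)"
    using assms by (intro sum.cong refl) simp
  finally show ?thesis .
qed

section \<open>The right and left eigenvector equations\<close>

definition ground_eigenvalue :: "nat \<Rightarrow> nat \<Rightarrow> real" where
  "ground_eigenvalue n m = 2 ^ n * (\<Prod>j=1..n. cos (pi * (real j - (real n + 1) / 2) / real m))"

lemma transfer_right:
  assumes "m > 0" "x \<in> configs n m"
  shows "(\<Sum>y\<in>configs n m. transfer_matrix n m x y * ground_state n m y) =
    ground_eigenvalue n m * ground_state n m x"
proof -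
  obtain X where X: "X \<in> alcove n m" "x = residues n m X"
    using assms(2) by (auto simp: configs_def)
  have "(\<Sum>y\<in>configs n m. transfer_matrix n m x y * ground_state n m y) =
      (\<Sum>J\<in>Pow {1..n}. if residues n m (\<lambda>j. X j + of_bool (j \<in> J)) \<in> configs n m
        then ground_state n m (residues n m (\<lambda>j. X j + of_bool (j \<in> J))) else 0)"
    unfolding transfer_matrix_def X(2) residues_residues_add
    by (rule sum_card_fibres) (simp_all add: finite_configs assms)
  also have "\<dots> = (\<Sum>J\<in>Pow {1..n}. sine_product n m (\<lambda>i. of_int (X i) + of_bool (i \<in> J)))"
    by (simp add: closed_alcove_ground_state[OF assms(1) alcove_shift_up[OF X(1)]])
  also have "\<dots> = ground_eigenvalue n m * sine_product n m (\<lambda>i. of_int (X i))"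
    unfolding ground_eigenvalue_def by (rule sine_product_step)
  also have "sine_product n m (\<lambda>i. of_int (X i)) = ground_state n m X"
    using sine_product_alcove_pos[OF X(1)] by (simp add: ground_state_def)
  also have "\<dots> = ground_state n m x"
    using assms(1) X(2) by (intro ground_state_cong) (simp_all add: residues_residues)
  finally show ?thesis .
qed

text \<open>Steps can be undone modulo \<open>m\<close>. In this form a column of the matrix is a
  count of backward steps, as needed for the left eigenvector and for removing the last step of a
  walk.\<close>

lemma transfer_eq_shift_down:
  assumes "residues n m x = x" "residues n m y = y"
  shows "transfer_matrix n m x y =
    real (card {J \<in> Pow {1..n}. residues n m (\<lambda>j. y j - of_bool (j \<in> J)) = x})"
proof -
  have "residues n m (\<lambda>j. x j + of_bool (j \<in> J)) = y \<longleftrightarrow>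
      residues n m (\<lambda>j. y j - of_bool (j \<in> J)) = x" for J
    using residues_residues_diff[of n m "\<lambda>j. x j + of_bool (j \<in> J)" "\<lambda>j. of_bool (j \<in> J)"]
      residues_residues_add[of n m "\<lambda>j. y j - of_bool (j \<in> J)" "\<lambda>j. of_bool (j \<in> J)"] assms
    by auto
  then show ?thesis by (simp add: transfer_matrix_def)
qed

text \<open>Subtracting the indicator of \<open>J\<close> is adding that of the complement and then
  translating all coordinates by -1, which the differences do not see.\<close>

lemma sine_product_step_down:
  "(\<Sum>J\<in>Pow {1..n}. sine_product n m (\<lambda>i. x i - of_bool (i \<in> J))) =
   ground_eigenvalue n m * sine_product n m x"
proof -
  have "(\<Sum>J\<in>Pow {1..n}. sine_product n m (\<lambda>i. x i - of_bool (i \<in> J))) =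
      (\<Sum>J\<in>Pow {1..n}. sine_product n m (\<lambda>i. x i + of_bool (i \<in> J)))"
  proof (rule sum.reindex_bij_witness[of _ "\<lambda>J. {1..n} - J" "\<lambda>J. {1..n} - J"])
    fix J assume "J \<in> Pow {1..n}"
    show "sine_product n m (\<lambda>i. x i + of_bool (i \<in> {1..n} - J)) = sine_product n m (\<lambda>i. x i - of_bool (i \<in> J))"
      unfolding sine_product_def by (intro prod.cong refl arg_cong[of _ _ sin]) (auto simp: of_bool_def)
  qed auto
  then show ?thesis
    unfolding ground_eigenvalue_def sine_product_step .
qed

lemma transfer_left:
  assumes "m > 0" "y \<in> configs n m"
  shows "(\<Sum>x\<in>configs n m. ground_state n m x * transfer_matrix n m x y) =
    ground_eigenvalue n m * ground_state n m y"
proof -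
  obtain Y where Y: "Y \<in> alcove n m" "y = residues n m Y"
    using assms(2) by (auto simp: configs_def)
  have "(\<Sum>x\<in>configs n m. ground_state n m x * transfer_matrix n m x y) =
      (\<Sum>x\<in>configs n m. real (card {J \<in> Pow {1..n}. residues n m (\<lambda>j. Y j - of_bool (j \<in> J)) = x}) *
        ground_state n m x)"
    by (intro sum.cong refl)
      (simp add: transfer_eq_shift_down residues_configs assms(2) Y(2) residues_residues residues_residues_diff)
  also have "\<dots> = (\<Sum>J\<in>Pow {1..n}. if residues n m (\<lambda>j. Y j - of_bool (j \<in> J)) \<in> configs n m
        then ground_state n m (residues n m (\<lambda>j. Y j - of_bool (j \<in> J))) else 0)"
    by (rule sum_card_fibres) (simp_all add: finite_configs assms)
  also have "\<dots> = (\<Sum>J\<in>Pow {1..n}. sine_product n m (\<lambda>i. of_int (Y i) - of_bool (i \<in> J)))"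
    by (simp add: closed_alcove_ground_state[OF assms(1) alcove_shift_down[OF Y(1)]])
  also have "\<dots> = ground_eigenvalue n m * sine_product n m (\<lambda>i. of_int (Y i))"
    by (rule sine_product_step_down)
  also have "sine_product n m (\<lambda>i. of_int (Y i)) = ground_state n m Y"
    using sine_product_alcove_pos[OF Y(1)] by (simp add: ground_state_def)
  also have "\<dots> = ground_state n m y"
    using assms(1) Y(2) by (intro ground_state_cong) (simp_all add: residues_residues)
  finally show ?thesis .
qed

section \<open>Positivity of the eigenvalue and primitivity of the matrix\<close>

text \<open>The distance of \<open>j\<close> from \<open>(n + 1) / 2\<close> is at most
  \<open>(n - 1) / 2\<close>, which is less than \<open>m / 2\<close>; so each angle lies strictly
  between \<open>- pi / 2\<close> and \<open>pi / 2\<close>.\<close>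

lemma ground_eigenvalue_pos:
  assumes "n \<le> m"
  shows "ground_eigenvalue n m > 0"
  unfolding ground_eigenvalue_def
proof (intro mult_pos_pos prod_pos cos_gt_zero_pi)
  fix j assume "j \<in> {1..n}"
  then have j: "1 \<le> real j" "real j \<le> real n" "m > 0" using assms by auto
  have "real n \<le> real m" using assms by simp
  have "- (real m / 2) < real j - (real n + 1) / 2" "real j - (real n + 1) / 2 < real m / 2"
    using j \<open>real n \<le> real m\<close> by (simp_all add: field_simps)
  then have "pi * (- (real m / 2)) < pi * (real j - (real n + 1) / 2)"
    "pi * (real j - (real n + 1) / 2) < pi * (real m / 2)"
    by (simp_all only: mult_less_cancel_left_pos pi_gt_zero)
  then show "- (pi / 2) < pi * (real j - (real n + 1) / 2) / real m"
    "pi * (real j - (real n + 1) / 2) / real m < pi / 2"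
    using \<open>m > 0\<close> by (simp_all add: field_simps)
qed simp

text \<open>The walk is built from its end: the point before \<open>Y\<close> is the maximum of
  \<open>X\<close> and \<open>Y - 1\<close>, so a coordinate rests at \<open>X j\<close> and then
  rises in all remaining steps. It stays in the alcove because the alcove is closed under
  coordinatewise maxima and common translations.\<close>

lemma walk_weight_pos_alcove:
  assumes "X \<in> alcove n m" "Y \<in> alcove n m" "m > 0"
    and "\<And>j. j \<in> {1..n} \<Longrightarrow> X j \<le> Y j \<and> Y j \<le> X j + int N"
  shows "walk_weight (configs n m) (transfer_matrix n m) N (residues n m X) (residues n m Y) > 0"
  using assms(2,4)
proof (induction N arbitrary: Y)
  case 0
  then have "residues n m X = residues n m Y"
    unfolding residues_eq_iff by fastforce
  then show ?case by simp
next
  case (Suc N)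
  define Z where "Z j = max (X j) (Y j - 1)" for j
  have Z: "Z \<in> alcove n m"
    using assms(1) Suc.prems(1) unfolding Z_def alcove_def by (fastforce simp: max_def)
  have "X j \<le> Z j \<and> Z j \<le> X j + int N" if "j \<in> {1..n}" for j
    using Suc.prems(2)[OF that] by (auto simp: Z_def)
  then have pos: "walk_weight (configs n m) (transfer_matrix n m) N (residues n m X) (residues n m Z) > 0"
    using Z Suc.IH by blast
  define J where "J = {j\<in>{1..n}. X j < Y j}"
  have "Z j + of_bool (j \<in> J) = Y j" if "j \<in> {1..n}" for j
    using Suc.prems(2)[OF that] that by (auto simp: Z_def J_def)
  then have "residues n m (\<lambda>j. residues n m Z j + of_bool (j \<in> J)) = residues n m Y"
    by (simp add: residues_residues_add residues_eq_iff)
  then have "J \<in> {J \<in> Pow {1..n}. residues n m (\<lambda>j. residues n m Z j + of_bool (j \<in> J)) = residues n m Y}"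
    by (auto simp: J_def)
  then have step: "transfer_matrix n m (residues n m Z) (residues n m Y) > 0"
    unfolding transfer_matrix_def by (subst of_nat_0_less_iff, subst card_gt_0_iff) auto
  have nonneg: "walk_weight (configs n m) (transfer_matrix n m) k x y \<ge> 0" for k x y
    by (induction k arbitrary: y) (auto intro!: sum_nonneg simp: transfer_matrix_def)
  have "0 < walk_weight (configs n m) (transfer_matrix n m) N (residues n m X) (residues n m Z) *
      transfer_matrix n m (residues n m Z) (residues n m Y)"
    using pos step by simp
  also have "\<dots> \<le> (\<Sum>z\<in>configs n m. walk_weight (configs n m) (transfer_matrix n m) N (residues n m X) z *
      transfer_matrix n m z (residues n m Y))"
    using Z assms(3) by (intro member_le_sum)
      (auto simp: configs_def[symmetric] finite_configs nonneg transfer_matrix_def intro: configs_def[THEN equalityD2, THEN subsetD])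
  finally show ?case by simp
qed

lemma walk_weight_configs_pos:
  assumes "m > 0"
  shows "\<exists>N. \<forall>x\<in>configs n m. \<forall>y\<in>configs n m. walk_weight (configs n m) (transfer_matrix n m) N x y > 0"
proof -
  \<comment> \<open>Positivity for all large \<open>N\<close>, not just for one, allows a single
    \<open>N\<close> to serve all of the finitely many pairs.\<close>
  have "\<forall>\<^sub>F N in sequentially. walk_weight (configs n m) (transfer_matrix n m) N x y > 0"
    if xy: "x \<in> configs n m" "y \<in> configs n m" for x y
  proof -
    obtain X Y where X: "X \<in> alcove n m" "x = residues n m X" and Y: "Y \<in> alcove n m" "y = residues n m Y"
      using xy by (auto simp: configs_def)
    \<comment> \<open>With this bound \<open>Y j - X j + c * int m\<close> lies between 0 and
      \<open>c + c * int m\<close>, which are the two inequalities required of the raised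
      target.\<close>
    define c where "c = (\<Sum>j=1..n. \<bar>X j\<bar> + \<bar>Y j\<bar>)"
    have c: "\<bar>X j\<bar> + \<bar>Y j\<bar> \<le> c" if "j \<in> {1..n}" for j
      unfolding c_def using that by (intro member_le_sum) auto
    have "c \<ge> 0" unfolding c_def by (intro sum_nonneg) auto
    then have "c \<le> c * int m" using assms by (simp add: mult_le_cancel_left1)
    \<comment> \<open>Steps only increase coordinates, so move \<open>Y\<close> above \<open>X\<close> within its residue class.\<close>
    define Z where "Z j = Y j + c * int m" for j
    have Z: "Z \<in> alcove n m" "y = residues n m Z"
      using Y by (auto simp: Z_def alcove_def residues_eq_iff)
    have "walk_weight (configs n m) (transfer_matrix n m) N x y > 0" if N: "N \<ge> nat (c + c * int m)" for N
      unfolding X(2) Z(2)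
    proof (rule walk_weight_pos_alcove[OF X(1) Z(1) assms])
      fix j assume "j \<in> {1..n}"
      from c[OF this] \<open>c \<le> c * int m\<close> N show "X j \<le> Z j \<and> Z j \<le> X j + int N"
        unfolding Z_def by linarith
    qed
    then show ?thesis
      unfolding eventually_sequentially by blast
  qed
  then have "\<forall>\<^sub>F N in sequentially. \<forall>x\<in>configs n m. \<forall>y\<in>configs n m.
      walk_weight (configs n m) (transfer_matrix n m) N x y > 0"
    using finite_configs[OF assms] by (simp add: eventually_ball_finite)
  then show ?thesis
    unfolding eventually_sequentially by blast
qed

lemma perron_eigenvector_ground_state:
  assumes "m > 0" "n \<le> m"
  shows "perron_eigenvector (configs n m) (transfer_matrix n m) (ground_state n m) (ground_eigenvalue n m)"
proof
qed (use assms in \<open>auto simp: finite_configs transfer_right transfer_left ground_state_configs_pos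
  ground_eigenvalue_pos walk_weight_configs_pos transfer_nonneg\<close>)

subsection \<open>The norm of the ground state\<close>

text \<open>For existence, match the increasing enumerations of \<open>I\<close> and
  \<open>g\<close> I\<open>; for uniqueness, the sorted list of\<close>g \<open>I\<close> determines
  all values \<open>g (p i)\<close>.\<close>

lemma ex1_sorting_permutation:
  fixes g :: "nat \<Rightarrow> nat"
  assumes "finite I" "inj_on g I"
  shows "\<exists>!p. p permutes I \<and> strict_mono_on I (\<lambda>i. g (p i))"
proof (rule ex_ex1I)
  obtain e where e: "bij_betw e {..<card I} I" "strict_mono_on {..<card I} e"
    using ex_bij_betw_strict_mono_card[OF assms(1)] .
  obtain f where f: "bij_betw f {..<card I} (g ` I)" "strict_mono_on {..<card I} f"
    using ex_bij_betw_strict_mono_card[of "g ` I"] assms by (metis card_image finite_imageI)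
  define r where "r = f \<circ> the_inv_into {..<card I} e"
  have r: "bij_betw r I (g ` I)"
    unfolding r_def using bij_betw_trans[OF bij_betw_the_inv_into[OF e(1)] f(1)] .
  define p where "p i = (if i \<in> I then the_inv_into I g (r i) else i)" for i
  have "bij_betw (the_inv_into I g \<circ> r) I I"
    using bij_betw_trans[OF r bij_betw_the_inv_into[OF inj_on_imp_bij_betw[OF assms(2)]]] .
  then have "bij_betw p I I"
    by (rule bij_betw_cong[THEN iffD1, rotated]) (simp add: p_def)
  then have "p permutes I"
    by (rule bij_imp_permutes) (simp add: p_def)
  moreover have "g (p i) = r i" if "i \<in> I" for i
    using that r assms(2) by (simp add: p_def f_the_inv_into_f bij_betwE)
  moreover have "strict_mono_on I r"
  proof (rule strict_mono_onI)
    fix i j assume ij: "i \<in> I" "j \<in> I" "i < j"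
    define a b where "a = the_inv_into {..<card I} e i" and "b = the_inv_into {..<card I} e j"
    have ab: "a < card I" "b < card I" "e a = i" "e b = j"
      using bij_betwE[OF bij_betw_the_inv_into[OF e(1)]] ij f_the_inv_into_f_bij_betw[OF e(1)]
      by (auto simp: a_def b_def)
    then have "a < b"
      using strict_mono_on_less[OF e(2), of a b] ij by auto
    then have "f a < f b"
      using f(2) ab by (auto simp: strict_mono_on_def)
    then show "r i < r j" by (simp add: r_def a_def b_def)
  qed
  ultimately show "\<exists>p. p permutes I \<and> strict_mono_on I (\<lambda>i. g (p i))"
    by (auto simp: strict_mono_on_def)
next
  fix p q assume p: "p permutes I \<and> strict_mono_on I (\<lambda>i. g (p i))"
    and q: "q permutes I \<and> strict_mono_on I (\<lambda>i. g (q i))"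
  have list: "map (\<lambda>i. g (s i)) (sorted_list_of_set I) = sorted_list_of_set (g ` I)"
    if s: "s permutes I \<and> strict_mono_on I (\<lambda>i. g (s i))" for s
  proof -
    let ?L = "sorted_list_of_set I"
    have "sorted_wrt (<) ?L" by simp
    then have "sorted_wrt (\<lambda>i j. g (s i) < g (s j)) ?L"
      by (rule sorted_wrt_mono_rel[rotated])
        (use assms(1) s in \<open>auto simp: strict_mono_on_def\<close>)
    then have "sorted_wrt (<) (map (\<lambda>i. g (s i)) ?L)"
      by (simp add: sorted_wrt_map)
    moreover have "set (map (\<lambda>i. g (s i)) ?L) = g ` I"
      using s assms(1) permutes_image[of s I] by (simp add: image_image[symmetric])
    ultimately show ?thesis
      using sorted_list_of_set.idem_if_sorted_distinct strict_sorted_iff by metis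
  qed
  have "g (p i) = g (q i)" if "i \<in> I" for i
    using list[OF p] list[OF q] that assms(1) by (metis map_eq_conv set_sorted_list_of_set)
  then have "p i = q i" if "i \<in> I" for i
    using that assms(2) p q by (metis inj_onD permutes_in_image)
  then show "p = q"
    using p q by (metis ext permutes_not_in)
qed

text \<open>
  The residue vectors from the alcove are those in which the clockwise distances from the first
  coordinate increase; hence permuting the coordinates \<open>2, \<dots>, n\<close> of a vector with distinct
  coordinates yields exactly one of them.
\<close>

definition gap :: "nat \<Rightarrow> (nat \<Rightarrow> int) \<Rightarrow> nat \<Rightarrow> nat" where
  "gap m x j = nat ((x 1 - x j) mod int m)"

lemma configs_iff_gap:
  assumes "n \<ge> 1" "m > 0"
  shows "x \<in> configs n m \<longleftrightarrow> x \<in> {1..n} \<rightarrow>\<^sub>E {0..<int m} \<and>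
    (\<forall>j\<in>{2..n}. gap m x j > 0) \<and> strict_mono_on {2..n} (gap m x)"
proof
  assume x: "x \<in> configs n m"
  then obtain X where X: "X \<in> alcove n m" "x = residues n m X"
    by (auto simp: configs_def)
  have gap: "gap m x j = nat (X 1 - X j)" "X j < X 1" if "j \<in> {2..n}" for j
  proof -
    have "X j < X 1 \<and> X 1 < X j + int m"
      using alcoveD[OF X(1), of 1 j] that by auto
    then show "gap m x j = nat (X 1 - X j)" "X j < X 1"
      using that assms(1) by (auto simp: gap_def X(2) residues_def mod_simps mod_pos_pos_trivial)
  qed
  have "gap m x i < gap m x j" if "i \<in> {2..n}" "j \<in> {2..n}" "i < j" for i j
    using gap[OF that(1)] gap[OF that(2)] alcoveD[OF X(1), of i j] that by auto
  then show "x \<in> {1..n} \<rightarrow>\<^sub>E {0..<int m} \<and>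
      (\<forall>j\<in>{2..n}. gap m x j > 0) \<and> strict_mono_on {2..n} (gap m x)"
    using gap configs_subset[OF assms(2), of n] x by (auto simp: strict_mono_on_def)
next
  assume x: "x \<in> {1..n} \<rightarrow>\<^sub>E {0..<int m} \<and>
    (\<forall>j\<in>{2..n}. gap m x j > 0) \<and> strict_mono_on {2..n} (gap m x)"
  \<comment> \<open>The lift that starts at \<open>x 1\<close> and descends by the clockwise
    distances. The first distance is 0, the others increase and stay below \<open>m\<close>, so the
    lift lies in the alcove.\<close>
  define X where "X j = x 1 - int (gap m x j)" for j
  have gap1: "gap m x 1 = 0" by (simp add: gap_def)
  have gap_less: "gap m x j < m" for j
    using assms(2) by (simp add: gap_def nat_less_iff)
  have gap_mono: "gap m x i < gap m x j" if "i \<in> {1..n}" "j \<in> {1..n}" "i < j" for i j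
  proof (cases "i = 1")
    case True
    then show ?thesis using that x gap1 by auto
  next
    case False
    then have "i \<in> {2..n}" "j \<in> {2..n}" using that by auto
    then show ?thesis using that x by (auto simp: strict_mono_on_def)
  qed
  have X: "X \<in> alcove n m"
    unfolding alcove_def
  proof (intro CollectI ballI impI)
    fix i j assume "i \<in> {1..n}" "j \<in> {1..n}" "i < j"
    from gap_mono[OF this] gap_less[of j] show "X j < X i \<and> X i < X j + int m"
      unfolding X_def by linarith
  qed
  have "x = residues n m X"
  proof (rule sym)
    show "residues n m X = x"
    proof
      fix j
      show "residues n m X j = x j"
      proof (cases "j \<in> {1..n}")
        case True
        then have "x j \<in> {0..<int m}" using x by (auto simp: PiE_iff)
        then have "X j mod int m = x j"
          using assms(2) by (simp add: X_def gap_def mod_simps mod_pos_pos_trivial)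
        with True show ?thesis by (simp add: residues_def)
      next
        case False
        have "x j = undefined" by (rule PiE_arb[OF conjunct1[OF x] False])
        with False show ?thesis by (auto simp: residues_def restrict_def)
      qed
    qed
  qed
  then show "x \<in> configs n m"
    unfolding configs_def using X by (rule image_eqI)
qed

text \<open>Squares are invariant under permuting coordinates, and exactly one of the
  \<open>fact (n - 1)\<close> reorderings of the coordinates 2, ..., n is a configuration. So the
  sum over all residue vectors is \<open>fact (n - 1)\<close> times the sum over configurations, and
  \<open>fact n / fact (n - 1)\<close> leaves the factor \<open>n\<close>.\<close>

lemma sum_configs_ground_state_squared:
  assumes "n \<ge> 1" "n \<le> m"
  shows "(\<Sum>x\<in>configs n m. (ground_state n m x)\<^sup>2) * 2 ^ (n\<^sup>2 - n) = real n * real m ^ n"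
proof -
  define X where "X = {1..n} \<rightarrow>\<^sub>E {0..<int m}"
  define Q where "Q = {p. p permutes {2..n}}"
  define F where "F x = (ground_state n m x)\<^sup>2" for x
  have m: "m > 0" using assms by simp
  have finX: "finite X" and finQ: "finite Q"
    by (auto simp: X_def Q_def finite_permutations intro: finite_PiE)
  have Q_permutes: "p permutes {1..n}" if "p \<in> Q" for p
    using that by (auto simp: Q_def intro: permutes_subset)
  have Q_fix: "p 1 = 1" if "p \<in> Q" for p
    using that by (auto simp: Q_def permutes_not_in)
  have comp_X: "(\<lambda>i. x (p i)) \<in> X" if "x \<in> X" "p permutes {1..n}" for x p
    using that permutes_in_image[OF that(2)] by (auto simp: X_def PiE_iff extensional_def)
  have F_comp: "F (\<lambda>i. x (p i)) = F x" if "p \<in> Q" for x p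
  proof -
    have "\<bar>real_of_int (sign p)\<bar> = 1" by (auto simp: sign_def)
    then show ?thesis
      using sine_product_permute[OF Q_permutes[OF that], of m "\<lambda>i. real_of_int (x i)"]
      by (simp add: F_def ground_state_def abs_mult)
  qed
  \<comment> \<open>Vectors with coinciding residues have \<open>F x = 0\<close>, so only those with
    distinct gaps need to be sorted.\<close>
  have unique: "(\<Sum>p\<in>Q. of_bool ((\<lambda>i. x (p i)) \<in> configs n m) * F x) = F x" if x: "x \<in> X" for x
  proof (cases "F x = 0")
    case False
    have neq: "x h mod int m \<noteq> x t mod int m" if "h \<in> {1..n}" "t \<in> {1..n}" "h \<noteq> t" for h t
      using False ground_state_eq_0[OF m that(1,2), of x] ground_state_eq_0[OF m that(2,1), of x] that(3)
      unfolding F_def by (cases h t rule: linorder_cases) auto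
    have gap_neq: "gap m x h \<noteq> gap m x t" if "h \<in> {1..n}" "t \<in> {1..n}" "h \<noteq> t" for h t
    proof
      assume "gap m x h = gap m x t"
      then have "(x 1 - x h) mod int m = (x 1 - x t) mod int m"
        using m by (simp add: gap_def nat_eq_iff)
      then have "(x 1 - (x 1 - x h)) mod int m = (x 1 - (x 1 - x t)) mod int m"
        by (rule mod_diff_cong[OF refl])
      then show False using neq[OF that] by simp
    qed
    have inj: "inj_on (gap m x) {2..n}"
      by (rule inj_onI, rule ccontr) (use gap_neq in auto)
    have pos: "gap m x j > 0" if "j \<in> {2..n}" for j
      using gap_neq[of 1 j] that assms(1) by (auto simp: gap_def)
    have "(\<lambda>i. x (p i)) \<in> configs n m \<longleftrightarrow> strict_mono_on {2..n} (\<lambda>i. gap m x (p i))" if p: "p \<in> Q" for p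
    proof -
      have "gap m (\<lambda>i. x (p i)) = (\<lambda>i. gap m x (p i))"
        using Q_fix[OF p] by (simp add: gap_def fun_eq_iff)
      moreover have "p j \<in> {2..n}" if "j \<in> {2..n}" for j
        using p that permutes_in_image[of p "{2..n}" j] by (simp add: Q_def)
      ultimately show ?thesis
        using comp_X[OF x Q_permutes[OF p]] pos
        unfolding configs_iff_gap[OF assms(1) m] X_def[symmetric] by simp
    qed
    note config_iff = this
    obtain p0 where p0: "p0 \<in> Q \<and> strict_mono_on {2..n} (\<lambda>i. gap m x (p0 i))"
      "\<And>p. p \<in> Q \<and> strict_mono_on {2..n} (\<lambda>i. gap m x (p i)) \<Longrightarrow> p = p0"
      using ex1_sorting_permutation[OF _ inj] unfolding Q_def by auto
    have "of_bool ((\<lambda>i. x (p i)) \<in> configs n m) * F x = (if p = p0 then F x else 0)"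
      if "p \<in> Q" for p
    proof (cases "p = p0")
      case True
      then show ?thesis using config_iff[OF that] p0(1) by simp
    next
      case False
      then have "\<not> strict_mono_on {2..n} (\<lambda>i. gap m x (p i))"
        using p0(2)[of p] that by blast
      with False show ?thesis using config_iff[OF that] by simp
    qed
    then have "(\<Sum>p\<in>Q. of_bool ((\<lambda>i. x (p i)) \<in> configs n m) * F x) = (\<Sum>p\<in>Q. if p = p0 then F x else 0)"
      by (intro sum.cong) auto
    then show ?thesis using p0(1) finQ by simp
  qed simp
  have "(\<Sum>x\<in>X. F x) = (\<Sum>x\<in>X. \<Sum>p\<in>Q. of_bool ((\<lambda>i. x (p i)) \<in> configs n m) * F x)"
    by (intro sum.cong refl unique[symmetric])
  also have "\<dots> = (\<Sum>p\<in>Q. \<Sum>x\<in>X. of_bool ((\<lambda>i. x (p i)) \<in> configs n m) * F x)"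
    by (rule sum.swap)
  also have "\<dots> = (\<Sum>p\<in>Q. \<Sum>y\<in>configs n m. F y)"
  proof (rule sum.cong[OF refl])
    fix p assume p: "p \<in> Q"
    note p' = Q_permutes[OF p]
    have "(\<Sum>x\<in>X. of_bool ((\<lambda>i. x (p i)) \<in> configs n m) * F x) =
        (\<Sum>y\<in>X. of_bool (y \<in> configs n m) * F y)"
    proof (rule sum.reindex_bij_witness[of _ "\<lambda>y i. y (inv p i)" "\<lambda>x i. x (p i)"])
      fix x assume x: "x \<in> X"
      show "(\<lambda>i. (\<lambda>i. x (p i)) (inv p i)) = x" "(\<lambda>i. (\<lambda>i. x (inv p i)) (p i)) = x"
        using permutes_inverses[OF p'] by simp_all
      show "(\<lambda>i. x (p i)) \<in> X" "(\<lambda>i. x (inv p i)) \<in> X"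
        using comp_X[OF x] p' permutes_inv[OF p'] by blast+
      show "of_bool ((\<lambda>i. x (p i)) \<in> configs n m) * F (\<lambda>i. x (p i)) =
          of_bool ((\<lambda>i. x (p i)) \<in> configs n m) * F x"
        by (simp add: F_comp[OF p])
    qed
    also have "\<dots> = (\<Sum>y\<in>configs n m. of_bool (y \<in> configs n m) * F y)"
      using finX configs_subset[OF m, of n] by (intro sum.mono_neutral_right) (auto simp: X_def)
    finally show "(\<Sum>x\<in>X. of_bool ((\<lambda>i. x (p i)) \<in> configs n m) * F x) = (\<Sum>y\<in>configs n m. F y)"
      by simp
  qed
  also have "\<dots> = fact (n - 1) * (\<Sum>y\<in>configs n m. F y)"
    by (simp add: Q_def card_permutations)
  finally have "fact (n - 1) * ((\<Sum>y\<in>configs n m. F y) * 2 ^ (n\<^sup>2 - n)) = (\<Sum>x\<in>X. F x) * 2 ^ (n\<^sup>2 - n)"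
    by simp
  also have "\<dots> = fact n * real m ^ n"
    unfolding F_def X_def ground_state_def power2_abs by (rule sum_sine_product_squared[OF assms(2)])
  also have "\<dots> = fact (n - 1) * (real n * real m ^ n)"
    using assms(1) by (simp add: fact_reduce)
  finally show ?thesis
    by (simp add: F_def)
qed

subsection \<open>Counting walks\<close>

abbreviation nonintersecting_walks ::
    "nat \<Rightarrow> nat \<Rightarrow> (nat \<Rightarrow> real) \<Rightarrow> (nat \<Rightarrow> real) \<Rightarrow> nat \<Rightarrow> (nat \<Rightarrow> nat \<Rightarrow> real) set" where
  "nonintersecting_walks n m \<eta> lam k \<equiv> {p \<in> diagonal_walks n m \<eta> lam k. nonintersecting n m k p}"

definition incongruent :: "nat \<Rightarrow> nat \<Rightarrow> (nat \<Rightarrow> real) \<Rightarrow> bool" where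
  "incongruent n m v \<longleftrightarrow> (\<forall>h\<in>{1..n}. \<forall>t\<in>{1..n}. h \<noteq> t \<longrightarrow> \<not> [v h = v t] (rmod real m))"

lemma incongruent_cong:
  assumes "\<And>j. j \<in> {1..n} \<Longrightarrow> [v j = w j] (rmod real m)"
  shows "incongruent n m v \<longleftrightarrow> incongruent n m w"
  unfolding incongruent_def using assms by (meson rcong_sym rcong_trans)

lemma nonintersecting_walks_0:
  assumes "incongruent n m \<eta>"
  shows "nonintersecting_walks n m \<eta> lam 0 =
    (if \<forall>j\<in>{1..n}. [\<eta> j = lam j] (rmod real m) then {\<lambda>i\<in>{0..0}. \<lambda>j\<in>{1..n}. \<eta> j} else {})"
proof -
  have start: "p = (\<lambda>i\<in>{0..0}. \<lambda>j\<in>{1..n}. \<eta> j)"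
    if "p \<in> {0..0} \<rightarrow>\<^sub>E ({1..n} \<rightarrow>\<^sub>E UNIV)" "\<forall>j\<in>{1..n}. p 0 j = \<eta> j" for p :: "nat \<Rightarrow> nat \<Rightarrow> real"
  proof (rule PiE_ext[OF that(1)])
    show "(\<lambda>i\<in>{0..0}. \<lambda>j\<in>{1..n}. \<eta> j) \<in> {0..0} \<rightarrow>\<^sub>E ({1..n} \<rightarrow>\<^sub>E UNIV)" by auto
    fix i :: nat assume "i \<in> {0..0}"
    then have i: "i = 0" by simp
    have "p 0 \<in> {1..n} \<rightarrow>\<^sub>E UNIV" by (rule PiE_mem[OF that(1)]) simp
    then have "p 0 = (\<lambda>j\<in>{1..n}. \<eta> j)"
      by (rule PiE_ext) (use that(2) in auto)
    then show "p i = (\<lambda>i\<in>{0..0}. \<lambda>j\<in>{1..n}. \<eta> j) i" by (simp add: i)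
  qed
  have walk: "(\<lambda>i\<in>{0..0}. \<lambda>j\<in>{1..n}. \<eta> j) \<in> nonintersecting_walks n m \<eta> lam 0"
    if "\<forall>j\<in>{1..n}. [\<eta> j = lam j] (rmod real m)"
    using that assms by (auto simp: diagonal_walks_def nonintersecting_def incongruent_def)
  have "p = (\<lambda>i\<in>{0..0}. \<lambda>j\<in>{1..n}. \<eta> j) \<and> (\<forall>j\<in>{1..n}. [\<eta> j = lam j] (rmod real m))"
    if "p \<in> nonintersecting_walks n m \<eta> lam 0" for p
    using that start[of p] by (auto simp: diagonal_walks_def)
  with walk show ?thesis by (auto split: if_splits)
qed

lemma nonintersecting_walks_empty:
  assumes "\<not> incongruent n m lam"
  shows "nonintersecting_walks n m \<eta> lam k = {}"
proof -
  have False if "p \<in> nonintersecting_walks n m \<eta> lam k" for p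
  proof -
    have "incongruent n m (p k)"
      using that by (simp add: nonintersecting_def incongruent_def)
    moreover have "[p k j = lam j] (rmod real m)" if "j \<in> {1..n}" for j
      using \<open>p \<in> _\<close> that by (simp add: diagonal_walks_def)
    ultimately show False using assms incongruent_cong by blast
  qed
  then show ?thesis by blast
qed

text \<open>\<open>J\<close> collects the coordinates whose last step is +1/2; the term
  \<open>of_bool (j \<in> J) - 1 / 2\<close> encodes both signs.\<close>

definition extend_walk :: "nat \<Rightarrow> nat \<Rightarrow> nat set \<times> (nat \<Rightarrow> nat \<Rightarrow> real) \<Rightarrow> nat \<Rightarrow> nat \<Rightarrow> real" where
  "extend_walk n k = (\<lambda>(J, p). p(Suc k := (\<lambda>j\<in>{1..n}. p k j + of_bool (j \<in> J) - 1 / 2)))"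

lemma extend_walk_simps:
  "i \<le> k \<Longrightarrow> extend_walk n k (J, p) i = p i"
  "extend_walk n k (J, p) (Suc k) = (\<lambda>j\<in>{1..n}. p k j + of_bool (j \<in> J) - 1 / 2)"
  by (auto simp: extend_walk_def)

lemma inj_on_extend_walk:
  "inj_on (extend_walk n k) (SIGMA J:Pow {1..n}. nonintersecting_walks n m \<eta> (lam J) k)"
proof (rule inj_onI, clarify)
  fix J p J' p'
  assume J: "J \<subseteq> {1..n}" "J' \<subseteq> {1..n}"
    and p: "p \<in> diagonal_walks n m \<eta> (lam J) k" "p' \<in> diagonal_walks n m \<eta> (lam J') k"
    and eq: "extend_walk n k (J, p) = extend_walk n k (J', p')"
  have "p i = p' i" if "i \<le> k" for i
    using fun_cong[OF eq, of i] that by (simp add: extend_walk_simps)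
  then have "p = p'"
    using p by (intro PiE_ext[of p "{0..k}" "\<lambda>_. {1..n} \<rightarrow>\<^sub>E UNIV" p']) (auto simp: diagonal_walks_def)
  moreover have "j \<in> J \<longleftrightarrow> j \<in> J'" if "j \<in> {1..n}" for j
    using fun_cong[OF fun_cong[OF eq, of "Suc k"], of j] that \<open>p = p'\<close>
    by (auto simp: extend_walk_simps of_bool_def split: if_splits)
  ultimately show "J = J' \<and> p = p'" using J by blast
qed

text \<open>The shortened walk ends at \<open>lam\<close> moved back along the last step. Since the
  new endpoint is congruent to \<open>lam\<close>, the assumption on \<open>lam\<close> is precisely
  the condition at the last time.\<close>

lemma extend_walk_image:
  assumes "incongruent n m lam"
  shows "extend_walk n k ` (SIGMA J:Pow {1..n}.
      nonintersecting_walks n m \<eta> (\<lambda>j. lam j + 1 / 2 - of_bool (j \<in> J)) k) =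
    nonintersecting_walks n m \<eta> lam (Suc k)"
proof (intro equalityI subsetI)
  fix q assume "q \<in> extend_walk n k ` (SIGMA J:Pow {1..n}.
      nonintersecting_walks n m \<eta> (\<lambda>j. lam j + 1 / 2 - of_bool (j \<in> J)) k)"
  then obtain J p where J: "J \<subseteq> {1..n}"
    and p: "p \<in> diagonal_walks n m \<eta> (\<lambda>j. lam j + 1 / 2 - of_bool (j \<in> J)) k"
      "nonintersecting n m k p"
    and q: "q = extend_walk n k (J, p)" by auto
  have end_cong: "[q (Suc k) j = lam j] (rmod real m)" if "j \<in> {1..n}" for j
  proof -
    have "[p k j = lam j + 1 / 2 - of_bool (j \<in> J)] (rmod real m)"
      using p that by (simp add: diagonal_walks_def)
    then have "[p k j + (of_bool (j \<in> J) - 1 / 2) =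
        (lam j + 1 / 2 - of_bool (j \<in> J)) + (of_bool (j \<in> J) - 1 / 2)] (rmod real m)"
      by (simp only: rcong_add_right_cancel)
    then show ?thesis
      using that by (simp add: q extend_walk_simps add_diff_eq)
  qed
  have "q \<in> {0..Suc k} \<rightarrow>\<^sub>E ({1..n} \<rightarrow>\<^sub>E UNIV)"
  proof (rule PiE_I)
    fix i assume "i \<in> {0..Suc k}"
    then consider "i \<le> k" | "i = Suc k" by force
    then show "q i \<in> {1..n} \<rightarrow>\<^sub>E UNIV"
    proof cases
      case 1
      then have "q i = p i" by (simp add: q extend_walk_simps)
      with 1 p(1) show ?thesis by (auto simp: diagonal_walks_def PiE_iff)
    qed (simp add: q extend_walk_simps)
  next
    fix i assume "i \<notin> {0..Suc k}"
    with p(1) show "q i = undefined"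
      by (auto simp: q extend_walk_def diagonal_walks_def PiE_iff extensional_def)
  qed
  moreover have "q (Suc i) j - q i j \<in> {1 / 2, - 1 / 2}" if "i < Suc k" "j \<in> {1..n}" for i j
  proof (cases "i = k")
    case True
    then show ?thesis using that by (simp add: q extend_walk_simps)
  next
    case False
    then have "i < k" using that by simp
    then show ?thesis using p(1) that by (simp add: q extend_walk_simps diagonal_walks_def)
  qed
  moreover have "q 0 j = \<eta> j" if "j \<in> {1..n}" for j
    using p(1) that by (simp add: q extend_walk_simps diagonal_walks_def)
  ultimately have "q \<in> diagonal_walks n m \<eta> lam (Suc k)"
    using end_cong by (auto simp: diagonal_walks_def)
  moreover have "incongruent n m (q (Suc k))"
    using end_cong assms incongruent_cong by blast
  then have "nonintersecting n m (Suc k) q"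
    using p(2) by (auto simp: nonintersecting_def incongruent_def le_Suc_eq q extend_walk_simps(1))
  ultimately show "q \<in> nonintersecting_walks n m \<eta> lam (Suc k)" by simp
next
  fix q assume "q \<in> nonintersecting_walks n m \<eta> lam (Suc k)"
  then have q: "q \<in> diagonal_walks n m \<eta> lam (Suc k)" "nonintersecting n m (Suc k) q" by auto
  define J where "J = {j\<in>{1..n}. q (Suc k) j - q k j = 1 / 2}"
  define p where "p = restrict q {0..k}"
  have step: "q (Suc k) j = q k j + of_bool (j \<in> J) - 1 / 2" if "j \<in> {1..n}" for j
  proof -
    have "q (Suc k) j - q k j \<in> {1 / 2, - 1 / 2}"
      using q(1) that by (simp add: diagonal_walks_def)
    then show ?thesis using that by (auto simp: J_def)
  qed
  have "[p k j = lam j + 1 / 2 - of_bool (j \<in> J)] (rmod real m)" if "j \<in> {1..n}" for j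
  proof -
    have "[q (Suc k) j = lam j] (rmod real m)"
      using q(1) that by (simp add: diagonal_walks_def)
    then have "[q (Suc k) j + (1 / 2 - of_bool (j \<in> J)) = lam j + (1 / 2 - of_bool (j \<in> J))] (rmod real m)"
      by (simp only: rcong_add_right_cancel)
    then show ?thesis
      unfolding step[OF that] by (simp add: p_def add_diff_eq)
  qed
  then have p: "p \<in> diagonal_walks n m \<eta> (\<lambda>j. lam j + 1 / 2 - of_bool (j \<in> J)) k"
    using q(1) by (auto simp: diagonal_walks_def p_def PiE_iff)
  have "nonintersecting n m k p"
    using q(2) by (auto simp: nonintersecting_def p_def)
  with p have "(J, p) \<in> (SIGMA J:Pow {1..n}.
      nonintersecting_walks n m \<eta> (\<lambda>j. lam j + 1 / 2 - of_bool (j \<in> J)) k)"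
    by (intro SigmaI PowI CollectI conjI) (auto simp only: J_def)
  moreover have "q = extend_walk n k (J, p)"
  proof
    fix i
    have Pi: "q \<in> {0..Suc k} \<rightarrow>\<^sub>E ({1..n} \<rightarrow>\<^sub>E UNIV)" using q(1) by (simp add: diagonal_walks_def)
    consider "i \<le> k" | "i = Suc k" | "i > Suc k" by linarith
    then show "q i = extend_walk n k (J, p) i"
    proof cases
      case 1
      then show ?thesis by (simp add: extend_walk_simps p_def)
    next
      case 2
      have "q (Suc k) \<in> {1..n} \<rightarrow>\<^sub>E UNIV" using Pi by (auto simp: PiE_iff)
      then have "q (Suc k) = (\<lambda>j\<in>{1..n}. p k j + of_bool (j \<in> J) - 1 / 2)"
        by (rule PiE_ext) (auto simp: step p_def)
      with 2 show ?thesis by (simp add: extend_walk_simps)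
    next
      case 3
      then have "q i = undefined" using Pi by (auto simp: PiE_iff extensional_def)
      with 3 show ?thesis by (simp add: extend_walk_def p_def)
    qed
  qed
  ultimately show "q \<in> extend_walk n k ` (SIGMA J:Pow {1..n}.
      nonintersecting_walks n m \<eta> (\<lambda>j. lam j + 1 / 2 - of_bool (j \<in> J)) k)"
    by (rule rev_image_eqI)
qed

text \<open>The ambient space of real-valued functions is infinite, so finiteness is drawn from the
  choice among finitely many last steps.\<close>

lemma finite_nonintersecting_walks:
  assumes "incongruent n m \<eta>"
  shows "finite (nonintersecting_walks n m \<eta> lam k)"
proof (induction k arbitrary: lam)
  case 0
  show ?case unfolding nonintersecting_walks_0[OF assms] by simp
next
  case (Suc k)
  show ?case
  proof (cases "incongruent n m lam")
    case True
    show ?thesis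
      unfolding extend_walk_image[OF True, symmetric] using Suc.IH by (intro finite_imageI finite_SigmaI) auto
  next
    case False
    show ?thesis by (subst nonintersecting_walks_empty[OF False]) simp
  qed
qed

lemma num_nonintersecting_walks_Suc:
  assumes "incongruent n m \<eta>"
  shows "num_nonintersecting_walks n m \<eta> lam (Suc k) =
    (if incongruent n m lam
     then \<Sum>J\<in>Pow {1..n}. num_nonintersecting_walks n m \<eta> (\<lambda>j. lam j + 1 / 2 - of_bool (j \<in> J)) k
     else 0)"
proof (cases "incongruent n m lam")
  case True
  have "num_nonintersecting_walks n m \<eta> lam (Suc k) =
      card (SIGMA J:Pow {1..n}. nonintersecting_walks n m \<eta> (\<lambda>j. lam j + 1 / 2 - of_bool (j \<in> J)) k)"
    unfolding num_nonintersecting_walks_def extend_walk_image[OF True, symmetric]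
    by (rule card_image[OF inj_on_extend_walk])
  also have "\<dots> = (\<Sum>J\<in>Pow {1..n}. num_nonintersecting_walks n m \<eta> (\<lambda>j. lam j + 1 / 2 - of_bool (j \<in> J)) k)"
    unfolding num_nonintersecting_walks_def
    by (rule card_SigmaI) (auto simp only: finite_nonintersecting_walks[OF assms] finite_Pow_iff finite_atLeastAtMost)
  finally show ?thesis using True by simp
next
  case False
  have "num_nonintersecting_walks n m \<eta> lam (Suc k) = 0"
    unfolding num_nonintersecting_walks_def by (subst nonintersecting_walks_empty[OF False]) simp
  with False show ?thesis by simp
qed

section \<open>Walk counts as entries of matrix powers\<close>

lemma rcong_of_int_iff:
  "[of_int a = of_int b] (rmod real m) \<longleftrightarrow> a mod int m = b mod int m"
proof -
  have "[of_int a = of_int b] (rmod real m) \<longleftrightarrow> (\<exists>q. real_of_int b = of_int a + of_int q * real m)"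
    by (simp add: rcong_altdef)
  also have "\<dots> \<longleftrightarrow> (\<exists>q. b = a + q * int m)"
  proof (rule arg_cong[of _ _ Ex], rule ext)
    fix q
    have "real_of_int a + of_int q * real m = of_int (a + q * int m)" by simp
    then show "real_of_int b = of_int a + of_int q * real m \<longleftrightarrow> b = a + q * int m"
      by (simp only: of_int_eq_iff)
  qed
  also have "\<dots> \<longleftrightarrow> int m dvd b - a"
    unfolding dvd_def by (intro arg_cong[of _ _ Ex] ext) (auto simp: algebra_simps)
  also have "\<dots> \<longleftrightarrow> a mod int m = b mod int m"
    by (metis mod_eq_dvd_iff)
  finally show ?thesis .
qed

text \<open>\<open>Y\<close> is the endpoint after the shift by \<open>k / 2\<close> and without the
  common offset \<open>e\<close>. The value 0 off the configurations is part of the induction,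
  because undoing a step may leave them.\<close>

lemma num_nonintersecting_walks_eq_walk_weight:
  assumes "m > 0" "X \<in> alcove n m"
    and \<eta>: "\<And>j. j \<in> {1..n} \<Longrightarrow> \<eta> j = of_int (X j) + e"
    and "\<And>j. j \<in> {1..n} \<Longrightarrow> lam j + real k / 2 = of_int (Y j) + e"
  shows "real (num_nonintersecting_walks n m \<eta> lam k) =
    (if residues n m Y \<in> configs n m
     then walk_weight (configs n m) (transfer_matrix n m) k (residues n m X) (residues n m Y) else 0)"
  using assms(4)
proof (induction k arbitrary: lam Y)
  have X: "residues n m X \<in> configs n m"
    using assms(2) by (auto simp: configs_def)
  have inc: "incongruent n m \<eta>"
    using residues_in_configs_incongruent[OF assms(1) X]
    by (auto simp: incongruent_def \<eta> rcong_of_int_iff)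
  {
    case 0
    then have lam: "lam j = of_int (Y j) + e" if "j \<in> {1..n}" for j using that by simp
    have "(\<forall>j\<in>{1..n}. [\<eta> j = lam j] (rmod real m)) \<longleftrightarrow> residues n m X = residues n m Y"
      unfolding residues_eq_iff by (intro ball_cong refl) (simp add: \<eta> lam rcong_of_int_iff)
    then show ?case
      using X unfolding num_nonintersecting_walks_def nonintersecting_walks_0[OF inc] by auto
  next
    case (Suc k)
    \<comment> \<open>Undoing a step adds 1/2 to \<open>lam j\<close> up to the indicator of
      \<open>J\<close>, and shortening the walk takes the same 1/2 from the shift; only the
      indicator remains.\<close>
    let ?Y = "\<lambda>J j. Y j - of_bool (j \<in> J)"
    have lam: "lam j = of_int (Y j) + (e - real (Suc k) / 2)" if "j \<in> {1..n}" for j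
      using Suc.prems[OF that] by simp
    have lam_inc: "incongruent n m lam \<longleftrightarrow> (\<forall>h\<in>{1..n}. \<forall>t\<in>{1..n}. h \<noteq> t \<longrightarrow> Y h mod int m \<noteq> Y t mod int m)"
      unfolding incongruent_def by (intro ball_cong refl) (simp add: lam rcong_of_int_iff)
    have IH: "real (num_nonintersecting_walks n m \<eta> (\<lambda>j. lam j + 1 / 2 - of_bool (j \<in> J)) k) =
        (if residues n m (?Y J) \<in> configs n m
         then walk_weight (configs n m) (transfer_matrix n m) k (residues n m X) (residues n m (?Y J)) else 0)" for J
    proof (rule Suc.IH)
      fix j assume "j \<in> {1..n}"
      then show "lam j + 1 / 2 - of_bool (j \<in> J) + real k / 2 = of_int (?Y J j) + e"
        by (simp add: lam field_simps)
    qed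
    show ?case
    proof (cases "residues n m Y \<in> configs n m")
      case True
      then have "incongruent n m lam"
        using residues_in_configs_incongruent[OF assms(1) True] by (simp add: lam_inc)
      then have "real (num_nonintersecting_walks n m \<eta> lam (Suc k)) =
          (\<Sum>J\<in>Pow {1..n}. if residues n m (?Y J) \<in> configs n m
            then walk_weight (configs n m) (transfer_matrix n m) k (residues n m X) (residues n m (?Y J)) else 0)"
        by (simp only: num_nonintersecting_walks_Suc[OF inc] if_True of_nat_sum IH)
      also have "\<dots> = (\<Sum>z\<in>configs n m. real (card {J \<in> Pow {1..n}. residues n m (?Y J) = z}) *
          walk_weight (configs n m) (transfer_matrix n m) k (residues n m X) z)"
        by (rule sum_card_fibres[symmetric]) (simp_all add: finite_configs assms)
      also have "\<dots> = (\<Sum>z\<in>configs n m. walk_weight (configs n m) (transfer_matrix n m) k (residues n m X) z *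
          transfer_matrix n m z (residues n m Y))"
        by (intro sum.cong refl)
          (simp add: transfer_eq_shift_down residues_configs residues_residues residues_residues_diff)
      finally show ?thesis using True by simp
    next
      case False
      have "real (num_nonintersecting_walks n m \<eta> lam (Suc k)) = 0"
      proof (cases "incongruent n m lam")
        case True
        \<comment> \<open>Here the endpoint has distinct residues in a wrong cyclic order. A
          predecessor from the alcove would place it in the closed alcove, and distinct residues
          would then place it in the alcove itself.\<close>
        have "residues n m (?Y J) \<notin> configs n m" for J
        proof
          assume "residues n m (?Y J) \<in> configs n m"
          then obtain Z where Z: "Z \<in> alcove n m" "residues n m (?Y J) = residues n m Z"
            by (auto simp: configs_def)
          let ?Z = "\<lambda>j. Z j + of_bool (j \<in> J)"
          have eq: "residues n m ?Z = residues n m Y"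
            using residues_residues_add[of n m "?Y J" "\<lambda>j. of_bool (j \<in> J)"]
              residues_residues_add[of n m Z "\<lambda>j. of_bool (j \<in> J)"] Z(2) by simp
          then have mod_eq: "?Z j mod int m = Y j mod int m" if "j \<in> {1..n}" for j
            using that unfolding residues_eq_iff by blast
          have "?Z \<in> alcove n m"
          proof (rule closed_alcove_incongruent[OF alcove_shift_up[OF Z(1)]])
            fix h t assume ht: "h \<in> {1..n}" "t \<in> {1..n}" "h < t"
            show "?Z h mod int m \<noteq> ?Z t mod int m"
              unfolding mod_eq[OF ht(1)] mod_eq[OF ht(2)] using ht True unfolding lam_inc by auto
          qed
          then have "residues n m Y \<in> configs n m"
            unfolding configs_def eq[symmetric] by (rule imageI)
          with \<open>residues n m Y \<notin> configs n m\<close> show False ..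
        qed
        then show ?thesis
          using True by (simp only: num_nonintersecting_walks_Suc[OF inc] if_True of_nat_sum IH) simp
      qed (simp add: num_nonintersecting_walks_Suc[OF inc])
      with False show ?thesis by simp
    qed
  }
qed

section \<open>The hypotheses of the theorem in terms of the alcove\<close>

lemma int_or_half_int_vectorE:
  assumes "int_or_half_int_vector n v"
  obtains X e where "\<forall>j\<in>{1..n}. v j = of_int (X j) + e" "2 * e \<in> \<int>"
proof -
  consider "\<forall>j\<in>{1..n}. v j \<in> \<int>" | "\<forall>j\<in>{1..n}. half_integer (v j)"
    using assms by (auto simp: int_or_half_int_vector_def)
  then show ?thesis
  proof cases
    case 1
    show ?thesis by (rule that[of "\<lambda>j. \<lfloor>v j\<rfloor>" 0]) (use 1 in auto)
  next
    case 2
    have "v j = of_int \<lfloor>v j\<rfloor> + 1 / 2" if j: "j \<in> {1..n}" for j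
    proof -
      obtain z :: int where "odd z" "v j = of_int z / 2"
        using 2 j unfolding half_integer_def by blast
      then obtain q where "z = 2 * q + 1" by (elim oddE)
      with \<open>v j = of_int z / 2\<close> have v: "v j = of_int q + 1 / 2" by (simp add: field_simps)
      then have "\<lfloor>v j\<rfloor> = q" by linarith
      with v show ?thesis by simp
    qed
    then have "\<forall>j\<in>{1..n}. v j = of_int \<lfloor>v j\<rfloor> + 1 / 2" by blast
    then show ?thesis by (rule that) simp
  qed
qed

text \<open>Applied to the target with the given \<open>s\<close> and to the start with
  \<open>s = 0\<close>.\<close>

lemma decreasing_chain_appendD:
  assumes "decreasing_chain m (map v ([Suc s..<Suc n] @ [1..<Suc s]))" "s \<le> n"
    and "i \<in> {1..n}" "j \<in> {1..n}"
  shows "0 \<le> v i \<and> v i < real m"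
    and "i < j \<Longrightarrow> i \<le> s \<longleftrightarrow> j \<le> s \<Longrightarrow> v j < v i"
    and "i \<le> s \<Longrightarrow> s < j \<Longrightarrow> v i < v j"
proof -
  have "v i \<in> set (map v ([Suc s..<Suc n] @ [1..<Suc s]))"
    using assms(2,3) by (cases "i \<le> s") (auto simp del: upt_Suc)
  then show "0 \<le> v i \<and> v i < real m"
    using assms(1) unfolding decreasing_chain_def by blast
  have sw: "sorted_wrt (\<lambda>a b. v a > v b) [Suc s..<Suc n]" "sorted_wrt (\<lambda>a b. v a > v b) [1..<Suc s]"
    and cross: "\<forall>a\<in>set [Suc s..<Suc n]. \<forall>b\<in>set [1..<Suc s]. v a > v b"
    using assms(1) by (auto simp: decreasing_chain_def sorted_wrt_append sorted_wrt_map simp del: upt_Suc)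
  have upt: "v b < v a" if "sorted_wrt (\<lambda>a b. v a > v b) [l..<r]" "l \<le> a" "a < b" "b < r" for l r a b
    using sorted_wrt_nth_less[OF that(1), of "a - l" "b - l"] that(2-4) by simp
  show "v j < v i" if "i < j" "i \<le> s \<longleftrightarrow> j \<le> s"
  proof (cases "i \<le> s")
    case True
    then show ?thesis using upt[OF sw(2), of i j] that assms by simp
  next
    case False
    then show ?thesis using upt[OF sw(1), of i j] that assms by simp
  qed
  show "v i < v j" if "i \<le> s" "s < j"
    using cross that assms by (auto simp del: upt_Suc)
qed

lemma residues_in_configs_if_chain:
  assumes "decreasing_chain m (map v ([Suc s..<Suc n] @ [1..<Suc s]))" "s \<le> n"
    and Y: "\<And>j. j \<in> {1..n} \<Longrightarrow> of_int (Y j) = v j + c"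
  shows "residues n m Y \<in> configs n m"
proof -
  \<comment> \<open>Adding \<open>m\<close> to the first \<open>s\<close> coordinates lifts them
    above the others and undoes the cyclic rotation in the chain.\<close>
  define Z where "Z j = Y j + (if j \<le> s then int m else 0)" for j
  have "Z \<in> alcove n m"
    unfolding alcove_def
  proof (intro CollectI ballI impI)
    fix i j assume ij: "i \<in> {1..n}" "j \<in> {1..n}" "i < j"
    note chain = decreasing_chain_appendD[OF assms(1,2)]
    have "real_of_int (Z j) < of_int (Z i) \<and> real_of_int (Z i) < of_int (Z j) + real m"
      using chain(1)[OF ij(1,1)] chain(1)[OF ij(2,2)] chain(2)[OF ij(1,2)] chain(3)[OF ij(1,2)] ij(3)
      by (cases "i \<le> s"; cases "j \<le> s") (auto simp: Z_def Y[OF ij(1)] Y[OF ij(2)])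
    then show "Z j < Z i \<and> Z i < Z j + int m" by linarith
  qed
  moreover have "residues n m Z = residues n m Y"
    by (auto simp: residues_eq_iff Z_def)
  ultimately show ?thesis unfolding configs_def by (metis imageI)
qed

lemma ground_state_eq_prod_abs_sin:
  assumes "\<And>j. j \<in> {1..n} \<Longrightarrow> of_int (Y j) = v j + c"
  shows "ground_state n m Y = (\<Prod>h=1..n. \<Prod>t\<in>{h<..n}. \<bar>sin (pi * (v h - v t) / real m)\<bar>)"
  unfolding ground_state_def sine_product_def abs_prod
  by (intro prod.cong refl) (use assms in auto)

theorem theorem19:
  fixes n m :: nat and \<eta> lam :: "nat \<Rightarrow> real"
  assumes "n \<ge> 1" and "m > 0"
    and "int_or_half_int_vector n \<eta>"
    and "decreasing_chain m (map \<eta> [1..<Suc n])"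
    and "int_or_half_int_vector n lam"
    and "\<exists>s\<le>n. decreasing_chain m (map lam ([Suc s..<Suc n] @ [1..<Suc s]))"
  shows "((\<lambda>k. real (num_nonintersecting_walks n m \<eta> lam k) /
            (2 ^ (n\<^sup>2 - n) / (real n * real m ^ n)
             * (2 ^ n * (\<Prod>j=1..n. cos (pi * (real j - (real n + 1) / 2) / real m))) ^ k
             * (\<Prod>h=1..n. \<Prod>t\<in>{h<..n}.
                  sin (pi * (\<eta> h - \<eta> t) / real m) * \<bar>sin (pi * (lam h - lam t) / real m)\<bar>)))
          \<longlongrightarrow> 1)
         (inf at_top (principal {k::nat. \<forall>j\<in>{1..n}. [real k = 2 * \<eta> j + 2 * lam j] (rmod 2)}))"
proof -
  obtain X e where "\<forall>j\<in>{1..n}. \<eta> j = of_int (X j) + e" "2 * e \<in> \<int>"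
    by (rule int_or_half_int_vectorE[OF assms(3)])
  then have X: "\<And>j. j \<in> {1..n} \<Longrightarrow> \<eta> j = of_int (X j) + e" "2 * e \<in> \<int>"
    by blast+
  obtain Z e' where "\<forall>j\<in>{1..n}. lam j = of_int (Z j) + e'" "2 * e' \<in> \<int>"
    by (rule int_or_half_int_vectorE[OF assms(5)])
  then have Z: "\<And>j. j \<in> {1..n} \<Longrightarrow> lam j = of_int (Z j) + e'" "2 * e' \<in> \<int>"
    by blast+
  obtain s where s: "s \<le> n" "decreasing_chain m (map lam ([Suc s..<Suc n] @ [1..<Suc s]))"
    using assms(6) by blast
  have \<eta>_chain: "decreasing_chain m (map \<eta> ([Suc 0..<Suc n] @ [1..<Suc 0]))"
    using assms(4) by simp
  have \<eta>_less: "\<eta> j < \<eta> i \<and> \<eta> i < \<eta> j + real m" if "i \<in> {1..n}" "j \<in> {1..n}" "i < j" for i j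
    using decreasing_chain_appendD(1)[OF \<eta>_chain, of i i] decreasing_chain_appendD(1)[OF \<eta>_chain, of j j]
      decreasing_chain_appendD(2)[OF \<eta>_chain, of i j] that by auto
  have X_alcove: "X \<in> alcove n m"
    unfolding alcove_def
  proof (intro CollectI ballI impI)
    fix i j assume ij: "i \<in> {1..n}" "j \<in> {1..n}" "i < j"
    show "X j < X i \<and> X i < X j + int m"
      using \<eta>_less[OF ij] unfolding X(1)[OF ij(1)] X(1)[OF ij(2)] by linarith
  qed
  \<comment> \<open>The start has \<open>n\<close> distinct residues modulo
    \<open>m\<close>.\<close>
  have "n \<le> m"
  proof -
    have "inj_on (\<lambda>j. X j mod int m) {1..n}"
      using residues_in_configs_incongruent[OF assms(2), of n X] X_alcove
      by (intro inj_onI) (metis configs_def imageI)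
    then have "card {1..n} \<le> card {0..<int m}"
      by (rule card_inj_on_le) (use assms(2) in auto)
    then show ?thesis by simp
  qed
  interpret perron_eigenvector "configs n m" "transfer_matrix n m" "ground_state n m" "ground_eigenvalue n m"
    by (rule perron_eigenvector_ground_state[OF assms(2) \<open>n \<le> m\<close>])
  define L where "L = (\<Sum>x\<in>configs n m. (ground_state n m x)\<^sup>2)"
  have L: "L * 2 ^ (n\<^sup>2 - n) = real n * real m ^ n"
    unfolding L_def by (rule sum_configs_ground_state_squared[OF assms(1) \<open>n \<le> m\<close>])
  have "L \<noteq> 0"
    using L assms by auto
  then have const: "2 ^ (n\<^sup>2 - n) / (real n * real m ^ n) = 1 / L"
    unfolding L[symmetric] by simp
  define x0 where "x0 = residues n m X"
  have x0: "x0 \<in> configs n m"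
    using X_alcove by (auto simp: configs_def x0_def)
  have g_x0: "ground_state n m x0 = (\<Prod>h=1..n. \<Prod>t\<in>{h<..n}. sin (pi * (\<eta> h - \<eta> t) / real m))"
  proof -
    have "ground_state n m x0 = ground_state n m X"
      unfolding x0_def using assms(2) by (intro ground_state_cong) (simp_all add: residues_residues)
    also have "\<dots> = sine_product n m (\<lambda>i. of_int (X i))"
      using sine_product_alcove_pos[OF X_alcove] by (simp add: ground_state_def)
    also have "\<dots> = (\<Prod>h=1..n. \<Prod>t\<in>{h<..n}. sin (pi * (\<eta> h - \<eta> t) / real m))"
      unfolding sine_product_def by (intro prod.cong refl) (use X(1) in auto)
    finally show ?thesis .
  qed
  have lim: "(\<lambda>k. ratio k x0 y * L) \<longlonglongrightarrow> 1" if "y \<in> configs n m" for y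
    using tendsto_mult[OF tendsto_ratio[OF _ x0 that] tendsto_const[of L]] x0 \<open>L \<noteq> 0\<close>
    by (auto simp: L_def)
  \<comment> \<open>The configuration \<open>y\<close> changes with \<open>k\<close>. As there are
    finitely many, convergence for each fixed \<open>y\<close> is uniform in \<open>y\<close>, which
    suffices.\<close>
  have eq: "\<exists>y\<in>configs n m. real (num_nonintersecting_walks n m \<eta> lam k) /
            (2 ^ (n\<^sup>2 - n) / (real n * real m ^ n)
             * (2 ^ n * (\<Prod>j=1..n. cos (pi * (real j - (real n + 1) / 2) / real m))) ^ k
             * (\<Prod>h=1..n. \<Prod>t\<in>{h<..n}.
                  sin (pi * (\<eta> h - \<eta> t) / real m) * \<bar>sin (pi * (lam h - lam t) / real m)\<bar>)) =
        ratio k x0 y * L"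
    if k: "\<forall>j\<in>{1..n}. [real k = 2 * \<eta> j + 2 * lam j] (rmod 2)" for k
  proof -
    \<comment> \<open>The floor is exact: by the congruence, \<open>real k / 2\<close> differs from
      \<open>\<eta> j + lam j\<close> by an integer, so the argument differs from
      \<open>of_int (X j) + 2 * lam j\<close> by an integer, and \<open>2 * lam j\<close> is an
      integer.\<close>
    define Y where "Y j = \<lfloor>lam j + real k / 2 - e\<rfloor>" for j
    have Y: "of_int (Y j) = lam j + (real k / 2 - e)" if j: "j \<in> {1..n}" for j
    proof -
      obtain q :: int where "2 * \<eta> j + 2 * lam j = real k + of_int q * 2"
        using k j unfolding rcong_altdef by blast
      then have "lam j + real k / 2 - e = of_int (X j) + 2 * of_int (Z j) + 2 * e' - of_int q"
        using X(1)[OF j] Z(1)[OF j] by (simp add: field_simps)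
      also have "\<dots> \<in> \<int>" using Z(2) by auto
      finally show ?thesis by (simp add: Y_def)
    qed
    define y where "y = residues n m Y"
    have y: "y \<in> configs n m"
      unfolding y_def by (rule residues_in_configs_if_chain[OF s(2,1) Y])
    have g_y: "ground_state n m y = (\<Prod>h=1..n. \<Prod>t\<in>{h<..n}. \<bar>sin (pi * (lam h - lam t) / real m)\<bar>)"
    proof -
      have "ground_state n m y = ground_state n m Y"
        unfolding y_def using assms(2) by (intro ground_state_cong) (simp_all add: residues_residues)
      then show ?thesis using ground_state_eq_prod_abs_sin[OF Y] by simp
    qed
    have "real (num_nonintersecting_walks n m \<eta> lam k) =
        (if residues n m Y \<in> configs n m
         then walk_weight (configs n m) (transfer_matrix n m) k (residues n m X) (residues n m Y) else 0)"
      by (rule num_nonintersecting_walks_eq_walk_weight[OF assms(2) X_alcove X(1)]) (use Y in auto)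
    then have num: "real (num_nonintersecting_walks n m \<eta> lam k) =
        walk_weight (configs n m) (transfer_matrix n m) k x0 y"
      using y by (simp add: x0_def y_def)
    show ?thesis
      unfolding num const prod.distrib g_x0[symmetric] g_y[symmetric] ground_eigenvalue_def[symmetric]
      using y by (intro bexI[of _ y]) (simp_all add: ratio_def mult_ac)
  qed
  show ?thesis
  proof (rule tendstoI)
    fix \<epsilon> :: real assume "\<epsilon> > 0"
    have "\<forall>\<^sub>F k in at_top. \<forall>y\<in>configs n m. dist (ratio k x0 y * L) 1 < \<epsilon>"
      using tendstoD[OF lim \<open>\<epsilon> > 0\<close>] finite_configs[OF assms(2)] by (simp add: eventually_ball_finite)
    then show "\<forall>\<^sub>F k in inf at_top (principal {k::nat. \<forall>j\<in>{1..n}. [real k = 2 * \<eta> j + 2 * lam j] (rmod 2)}).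
        dist (real (num_nonintersecting_walks n m \<eta> lam k) /
            (2 ^ (n\<^sup>2 - n) / (real n * real m ^ n)
             * (2 ^ n * (\<Prod>j=1..n. cos (pi * (real j - (real n + 1) / 2) / real m))) ^ k
             * (\<Prod>h=1..n. \<Prod>t\<in>{h<..n}.
                  sin (pi * (\<eta> h - \<eta> t) / real m) * \<bar>sin (pi * (lam h - lam t) / real m)\<bar>))) 1 < \<epsilon>"
      unfolding eventually_inf_principal
    proof eventually_elim
      case (elim k)
      show ?case
      proof
        assume "k \<in> {k. \<forall>j\<in>{1..n}. [real k = 2 * \<eta> j + 2 * lam j] (rmod 2)}"
        then have "\<forall>j\<in>{1..n}. [real k = 2 * \<eta> j + 2 * lam j] (rmod 2)" by simp
        from eq[OF this] elim show "dist (real (num_nonintersecting_walks n m \<eta> lam k) /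
            (2 ^ (n\<^sup>2 - n) / (real n * real m ^ n)
             * (2 ^ n * (\<Prod>j=1..n. cos (pi * (real j - (real n + 1) / 2) / real m))) ^ k
             * (\<Prod>h=1..n. \<Prod>t\<in>{h<..n}.
                  sin (pi * (\<eta> h - \<eta> t) / real m) * \<bar>sin (pi * (lam h - lam t) / real m)\<bar>))) 1 < \<epsilon>"
          by (metis (no_types, lifting))
      qed
    qed
  qed
qed

end
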